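(* Let $M$ and $N$ be matroids on a common countable edge set $E$ such that each of them is either nearly finitary or nearly cofinitary. Then there is a base of $N$ which is independent in $M$ if and only if $\mathsf{cond}(M,N)$ holds.
   Context: A (possibly infinite) matroid is a pair $M=(E,\mathcal I)$ with $\mathcal I\subseteq\mathcal P(E)$ such that: (1) $\varnothing\in\mathcal I$; (2) $\mathcal I$ is downward closed; (3) for all $I,J\in\mathcal I$ where $J$ is $\subseteq$-maximal in $\mathcal I$ but $I$ is not, there is $e\in J\setminus I$ with $I+e:=I\cup\{e\}\in\mathcal I$; (4) for every $X\subseteq E$, any $I\in\mathcal I\cap\mathcal P(X)$ can be extended to a $\subseteq$-maximal element of $\mathcal I\cap\mathcal P(X)$. Members of $\mathcal I$ are independent, maximal independent sets are bases, minimal dependent sets are circuits. The dual $M^*$ is the matroid on $E$ whose bases are the complements of the bases of $M$. The restriction is $M\upharpoonright X:=(X,\mathcal I\cap\mathcal P(X))$, deletion is $M-X:=M\upharpoonright(E\setminus X)$, contraction is $M/X:=(M^*-X)^*$, and the contraction onto $X$ is $M.X:=M/(E\setminus X)$ (a matroid on $X$). $\mathsf{cond}(M,N)$ is the condition: for every $W\subseteq E$ for which there is a base of $M\upharpoonright W$ that is independent in $N.W$, there exists a base of $N.W$ which is independent in $M\upharpoonright W$. A matroid is finitary if all of its circuits are finite. The finitarization of $M$ is the matroid on the same edge set whose circuits are exactly the finite circuits of $M$. $M$ is nearly finitary if every base of $M$ can be extended to a base of its finitarization by adding finitely many edges. $M$ is nearly cofinitary if $M^*$ is nearly finitary. *)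

theory Defs
  imports Main "HOL-Library.Countable_Set"
begin

text \<open>Possibly infinite matroids are pairs of a ground set and a family of independent sets.\<close>

type_synonym 'a matroid = "'a set \<times> 'a set set"

abbreviation ground :: "'a matroid \<Rightarrow> 'a set" where
  "ground M \<equiv> fst M"

abbreviation indeps :: "'a matroid \<Rightarrow> 'a set set" where
  "indeps M \<equiv> snd M"

definition maximal_in :: "'a set set \<Rightarrow> 'a set \<Rightarrow> bool" where
  "maximal_in F J \<longleftrightarrow> J \<in> F \<and> (\<forall>K\<in>F. J \<subseteq> K \<longrightarrow> K = J)"

definition matroid :: "'a matroid \<Rightarrow> bool" where
  "matroid M \<longleftrightarrow>
     indeps M \<subseteq> Pow (ground M) \<and>
     {} \<in> indeps M \<and>
     (\<forall>I\<in>indeps M. \<forall>J. J \<subseteq> I \<longrightarrow> J \<in> indeps M) \<and>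
     (\<forall>I\<in>indeps M. \<forall>J\<in>indeps M.
        maximal_in (indeps M) J \<and> \<not> maximal_in (indeps M) I \<longrightarrow>
          (\<exists>e\<in>J - I. insert e I \<in> indeps M)) \<and>
     (\<forall>X. X \<subseteq> ground M \<longrightarrow>
        (\<forall>I\<in>indeps M \<inter> Pow X. \<exists>J. I \<subseteq> J \<and> maximal_in (indeps M \<inter> Pow X) J))"

definition base :: "'a matroid \<Rightarrow> 'a set \<Rightarrow> bool" where
  "base M B \<longleftrightarrow> maximal_in (indeps M) B"

definition circuit :: "'a matroid \<Rightarrow> 'a set \<Rightarrow> bool" where
  "circuit M C \<longleftrightarrow>
     C \<subseteq> ground M \<and> C \<notin> indeps M \<and>
     (\<forall>D. D \<subseteq> C \<and> D \<notin> indeps M \<longrightarrow> D = C)"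

text \<open>A matroid is determined by its bases, its independent sets being the subsets of bases.
  Hence the dual, whose bases are the complements of the bases of \<open>M\<close>, has the following
  independent sets.\<close>

definition matroid_dual :: "'a matroid \<Rightarrow> 'a matroid" where
  "matroid_dual M = (ground M, {I. \<exists>B. base M B \<and> I \<subseteq> ground M - B})"

lemma base_matroid_dual_iff:
  assumes "matroid M"
  shows "base (matroid_dual M) D \<longleftrightarrow> (\<exists>B. base M B \<and> D = ground M - B)"
proof
  assume D: "base (matroid_dual M) D"
  then have "D \<in> indeps (matroid_dual M)" unfolding base_def maximal_in_def by blast
  then obtain B where B: "base M B" "D \<subseteq> ground M - B" unfolding matroid_dual_def by auto
  have "ground M - B \<in> indeps (matroid_dual M)" using B(1) unfolding matroid_dual_def by auto
  then have "ground M - B = D" using D B(2) unfolding base_def maximal_in_def by blast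
  then show "\<exists>B. base M B \<and> D = ground M - B" using B(1) by blast
next
  assume "\<exists>B. base M B \<and> D = ground M - B"
  then obtain B where B: "base M B" "D = ground M - B" by blast
  have "indeps M \<subseteq> Pow (ground M)" using assms unfolding matroid_def by (rule conjunct1)
  then have ground: "A \<subseteq> ground M" if "base M A" for A
    using that unfolding base_def maximal_in_def by blast
  have "K = D" if K: "K \<in> indeps (matroid_dual M)" "D \<subseteq> K" for K
  proof -
    obtain B' where B': "base M B'" "K \<subseteq> ground M - B'"
      using K(1) unfolding matroid_dual_def by auto
    have "B' \<subseteq> B" using ground[OF B'(1)] B'(2) K(2) B(2) by blast
    then have "B' = B" using B(1) B'(1) unfolding base_def maximal_in_def by blast
    then show ?thesis using B'(2) K(2) B(2) by blast
  qed
  moreover have "D \<in> indeps (matroid_dual M)" using B unfolding matroid_dual_def by auto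
  ultimately show "base (matroid_dual M) D"
    unfolding base_def[of "matroid_dual M"] maximal_in_def by blast
qed

definition matroid_restrict :: "'a matroid \<Rightarrow> 'a set \<Rightarrow> 'a matroid" where
  "matroid_restrict M X = (X, indeps M \<inter> Pow X)"

definition matroid_delete :: "'a matroid \<Rightarrow> 'a set \<Rightarrow> 'a matroid" where
  "matroid_delete M X = matroid_restrict M (ground M - X)"

definition matroid_contract :: "'a matroid \<Rightarrow> 'a set \<Rightarrow> 'a matroid" where
  "matroid_contract M X = matroid_dual (matroid_delete (matroid_dual M) X)"

definition contract_onto :: "'a matroid \<Rightarrow> 'a set \<Rightarrow> 'a matroid" where
  "contract_onto M X = matroid_contract M (ground M - X)"

definition cond :: "'a matroid \<Rightarrow> 'a matroid \<Rightarrow> bool" where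
  "cond M N \<longleftrightarrow>
     (\<forall>W. W \<subseteq> ground M \<longrightarrow>
        (\<exists>B. base (matroid_restrict M W) B \<and> B \<in> indeps (contract_onto N W)) \<longrightarrow>
        (\<exists>B. base (contract_onto N W) B \<and> B \<in> indeps (matroid_restrict M W)))"

text \<open>A matroid is determined by its circuits, its independent sets being those subsets of the
  ground set that include no circuit. Hence the matroid whose circuits are exactly the finite
  circuits of \<open>M\<close> has the following independent sets.\<close>

definition finitarization :: "'a matroid \<Rightarrow> 'a matroid" where
  "finitarization M =
     (ground M, {I. I \<subseteq> ground M \<and> \<not> (\<exists>C. circuit M C \<and> finite C \<and> C \<subseteq> I)})"

lemma circuit_finitarization_iff:
  "circuit (finitarization M) C \<longleftrightarrow> circuit M C \<and> finite C"
proof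
  assume L: "circuit (finitarization M) C"
  then have "C \<subseteq> ground (finitarization M)" "C \<notin> indeps (finitarization M)"
    unfolding circuit_def by blast+
  then obtain D where D: "circuit M D" "finite D" "D \<subseteq> C"
    unfolding finitarization_def fst_conv snd_conv by blast
  have "D \<notin> indeps (finitarization M)"
    using D unfolding finitarization_def snd_conv by blast
  then have "D = C" using L D(3) unfolding circuit_def[of "finitarization M"] by blast
  then show "circuit M C \<and> finite C" using D by blast
next
  assume R: "circuit M C \<and> finite C"
  have "D = C" if D: "D \<subseteq> C" "D \<notin> indeps (finitarization M)" for D
  proof -
    have "D \<subseteq> ground M" using D(1) R unfolding circuit_def by blast
    then obtain D' where "circuit M D'" "D' \<subseteq> D"
      using D(2) unfolding finitarization_def snd_conv by blast
    then have "D' \<notin> indeps M" "D' \<subseteq> C" using D(1) unfolding circuit_def by blast+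
    then have "D' = C" using R unfolding circuit_def by blast
    then show ?thesis using \<open>D' \<subseteq> D\<close> D(1) by (simp add: subset_antisym)
  qed
  moreover have "C \<subseteq> ground (finitarization M)"
    using R unfolding finitarization_def circuit_def fst_conv by (elim conjE)
  moreover have "C \<notin> indeps (finitarization M)"
    using R unfolding finitarization_def snd_conv by blast
  ultimately show "circuit (finitarization M) C"
    unfolding circuit_def[of "finitarization M"] by blast
qed

definition nearly_finitary :: "'a matroid \<Rightarrow> bool" where
  "nearly_finitary M \<longleftrightarrow>
     (\<forall>B. base M B \<longrightarrow> (\<exists>F. finite F \<and> base (finitarization M) (B \<union> F)))"

definition nearly_cofinitary :: "'a matroid \<Rightarrow> bool" where
  "nearly_cofinitary M \<longleftrightarrow> nearly_finitary (matroid_dual M)"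

end

theory Submission
  imports Defs
begin

text \<open>Matroids are handled through their closure operators, extended to the whole type by making all
  elements outside the ground set loops.

  The pair \<open>(M, N)\<close> has the intersection property if some common independent set \<open>I\<close> and some
  partition \<open>R \<union> S\<close> of the edges are such that \<open>I \<inter> R\<close> spans \<open>R\<close> in \<open>M\<close> and \<open>I \<inter> S\<close> spans \<open>S\<close> in \<open>N\<close>.
  Then \<open>R\<close> witnesses the hypothesis of the condition \<open>cond\<close>, and replacing \<open>I \<inter> R\<close> by the base of
  \<open>N.R\<close> provided by \<open>cond\<close> gives a base of \<open>N\<close> that is independent in \<open>M\<close>. The property is symmetric,
  invariant under duality, and passes from the finitarization of \<open>M\<close> to \<open>M\<close> if \<open>M\<close> is nearly finitary,
  because a finite deficiency can be repaired by augmenting paths. So two cases remain.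

  A wave is an independent set \<open>A\<close> of \<open>M\<close> that is independent in \<open>N\<close> contracted onto the closure of
  \<open>A\<close> in \<open>M\<close>. Splitting off a maximal wave leaves a pair without nonempty waves, for which a base of
  \<open>N\<close> independent in \<open>M\<close> is needed. If \<open>M\<close> is finitary and \<open>N\<close> is cofinitary, compactness reduces
  this to finite minors, where augmenting paths suffice. If both are finitary, a common independent set
  is called feasible if contracting it leaves no wave except the empty set. Every element can be spanned
  by a feasible set: iterated augmentation, each time from the first possible element, cannot
  neglect an element forever, since this would produce a nonempty wave. Doing this for all elements
  in turn gives an increasing sequence of feasible sets, whose union is the required base.\<close>


section \<open>Matroids as closure operators\<close>

definition indep :: "('a set \<Rightarrow> 'a set) \<Rightarrow> 'a set \<Rightarrow> bool" where
  "indep f A \<longleftrightarrow> (\<forall>a\<in>A. a \<notin> f (A - {a}))"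

definition cl_contract :: "('a set \<Rightarrow> 'a set) \<Rightarrow> 'a set \<Rightarrow> 'a set \<Rightarrow> 'a set" where
  "cl_contract f Y X = f (X \<union> Y)"

text \<open>Deletion keeps the deleted elements as loops, just as contraction does.\<close>

definition cl_delete :: "('a set \<Rightarrow> 'a set) \<Rightarrow> 'a set \<Rightarrow> 'a set \<Rightarrow> 'a set" where
  "cl_delete f W X = f (X - W) \<union> W"

text \<open>Orthogonality: if \<open>E\<close> is split into \<open>A\<close>, \<open>B\<close> and
  a single \<open>e\<close>, then \<open>B\<close> spans \<open>e\<close> in the dual exactly if
  \<open>A\<close> does not span \<open>e\<close> in \<open>f\<close>. Elements outside
  \<open>E\<close> become loops.\<close>

definition cl_dual :: "'a set \<Rightarrow> ('a set \<Rightarrow> 'a set) \<Rightarrow> 'a set \<Rightarrow> 'a set" where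
  "cl_dual E f X = {e. e \<in> X \<or> e \<notin> E \<or> e \<notin> f (E - X - {e})}"

definition cl_fin :: "('a set \<Rightarrow> 'a set) \<Rightarrow> 'a set \<Rightarrow> 'a set" where
  "cl_fin f X = {e. \<exists>F. F \<subseteq> X \<and> finite F \<and> e \<in> f F}"

definition finitary :: "('a set \<Rightarrow> 'a set) \<Rightarrow> bool" where
  "finitary f \<longleftrightarrow> (\<forall>X. \<forall>x\<in>f X. \<exists>F. F \<subseteq> X \<and> finite F \<and> x \<in> f F)"

text \<open>For independent \<open>I\<close> spanning \<open>x\<close> outside \<open>I\<close>,
  this is the fundamental circuit of \<open>x\<close> without \<open>x\<close> itself; for
  \<open>x\<close> in an independent \<open>I\<close> it is \<open>{x}\<close>.\<close>

definition fund_circuit :: "('a set \<Rightarrow> 'a set) \<Rightarrow> 'a set \<Rightarrow> 'a \<Rightarrow> 'a set" where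
  "fund_circuit f I x = {y\<in>I. x \<notin> f (I - {y})}"

lemma finitaryD: "finitary f \<Longrightarrow> x \<in> f X \<Longrightarrow> \<exists>F. F \<subseteq> X \<and> finite F \<and> x \<in> f F"
  unfolding finitary_def by blast

locale closure_op =
  fixes cl :: "'a set \<Rightarrow> 'a set"
  assumes ext: "X \<subseteq> cl X"
    and mono: "X \<subseteq> Y \<Longrightarrow> cl X \<subseteq> cl Y"
    and idem: "cl (cl X) \<subseteq> cl X"
    and exch: "y \<in> cl (insert x X) \<Longrightarrow> y \<notin> cl X \<Longrightarrow> x \<in> cl (insert y X)"
begin

lemma cl_least: "X \<subseteq> cl Y \<Longrightarrow> cl X \<subseteq> cl Y"
  using mono[of X "cl Y"] idem[of Y] by blast

lemma cl_mem: "x \<in> cl X \<Longrightarrow> X \<subseteq> cl Y \<Longrightarrow> x \<in> cl Y"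
  using cl_least by blast

lemma cl_eqI: "X \<subseteq> cl Y \<Longrightarrow> Y \<subseteq> cl X \<Longrightarrow> cl X = cl Y"
  using cl_least by blast

lemma cl_Un_cong: "cl X = cl Y \<Longrightarrow> cl (Z \<union> X) = cl (Z \<union> Y)"
  using ext[of X] ext[of Y] ext[of "Z \<union> X"] ext[of "Z \<union> Y"] mono[of X "Z \<union> X"] mono[of Y "Z \<union> Y"]
  by (intro cl_eqI) blast+

lemma cl_insert_cong: "cl X = cl Y \<Longrightarrow> cl (insert z X) = cl (insert z Y)"
  using cl_Un_cong[of X Y "{z}"] by simp

lemma indep_subset: "indep cl A \<Longrightarrow> B \<subseteq> A \<Longrightarrow> indep cl B"
  unfolding indep_def using mono by (meson Diff_mono subsetD subset_refl)

lemma indep_empty [simp]: "indep cl {}"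
  by (simp add: indep_def)

lemma indep_insert:
  assumes "indep cl A" "x \<notin> cl A"
  shows "indep cl (insert x A)"
  unfolding indep_def
proof
  fix a assume a: "a \<in> insert x A"
  show "a \<notin> cl (insert x A - {a})"
  proof (cases "a = x")
    case True
    then show ?thesis using assms(2) ext[of A] by (metis Diff_insert_absorb insert_Diff1 singletonI subsetD)
  next
    case False
    then have aA: "a \<in> A" using a by simp
    have e: "insert x A - {a} = insert x (A - {a})" using False by auto
    have na: "a \<notin> cl (A - {a})" using assms(1) aA by (simp add: indep_def)
    show ?thesis
      using exch[of a x "A - {a}"] na assms(2) aA e by (metis insert_Diff)
  qed
qed

lemma indep_not_loop: "indep cl A \<Longrightarrow> a \<in> A \<Longrightarrow> a \<notin> cl {}"
  unfolding indep_def using mono[of "{}" "A - {a}"] by blast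

text \<open>A dependency of a finitary operator involves finitely many elements, and a single member
  of the chain contains them.\<close>

lemma indep_chain_Union:
  assumes "finitary cl" "\<And>A B. A \<in> C \<Longrightarrow> B \<in> C \<Longrightarrow> A \<subseteq> B \<or> B \<subseteq> A" "\<And>A. A \<in> C \<Longrightarrow> indep cl A"
  shows "indep cl (\<Union> C)"
  unfolding indep_def
proof
  fix a assume a: "a \<in> \<Union> C"
  show "a \<notin> cl (\<Union> C - {a})"
  proof
    assume "a \<in> cl (\<Union> C - {a})"
    then obtain F where F: "F \<subseteq> \<Union> C - {a}" "finite F" "a \<in> cl F" using finitaryD[OF assms(1)] by blast
    have "finite (insert a F)" "insert a F \<subseteq> \<Union> C" using F a by auto
    moreover have "C \<noteq> {}" using a by blast
    moreover have "subset.chain UNIV C" using assms(2) by (auto simp: subset.chain_def)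
    ultimately obtain A where "A \<in> C" "insert a F \<subseteq> A"
      using finite_subset_Union_chain[of "insert a F" C] by blast
    then have "F \<subseteq> A - {a}" "a \<in> A" "indep cl A" using F(1) assms(3) by auto
    then show False using F(3) mono unfolding indep_def by blast
  qed
qed

end

text \<open>\<open>basis\<close> is axiom (4) with maximality in \<open>X\<close> replaced by
  spanning \<open>X\<close>. An exchange closure on an infinite set need not have bases
  otherwise.\<close>

locale imatroid = closure_op +
  assumes basis: "indep cl I \<Longrightarrow> I \<subseteq> X \<Longrightarrow> \<exists>B. I \<subseteq> B \<and> B \<subseteq> X \<and> indep cl B \<and> X \<subseteq> cl B"
begin

text \<open>If the circuit did not span \<open>x\<close>, then \<open>x\<close> and the circuit
  would extend to a base of \<open>insert x I\<close> that misses some \<open>y\<close> of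
  \<open>I\<close> outside the circuit. As \<open>I - {y}\<close> spans \<open>x\<close>, it spans
  this base and hence \<open>y\<close>, against the independence of \<open>I\<close>.\<close>

lemma span_fund_circuit:
  assumes I: "indep cl I" and x: "x \<in> cl I"
  shows "x \<in> cl (fund_circuit cl I x)"
proof (cases "x \<in> I")
  case True
  then have "x \<in> fund_circuit cl I x" using I by (simp add: fund_circuit_def indep_def)
  then show ?thesis using ext by blast
next
  case False
  show ?thesis
  proof (rule ccontr)
    assume n: "x \<notin> cl (fund_circuit cl I x)"
    let ?C = "fund_circuit cl I x"
    have CI: "?C \<subseteq> I" by (auto simp: fund_circuit_def)
    have "indep cl (insert x ?C)" using indep_insert[OF indep_subset[OF I CI] n] .
    then obtain B where B: "insert x ?C \<subseteq> B" "B \<subseteq> insert x I" "indep cl B" "insert x I \<subseteq> cl B"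
      using basis[of "insert x ?C" "insert x I"] CI by blast
    have "\<not> I \<subseteq> B"
    proof
      assume "I \<subseteq> B"
      then have "B = insert x I" using B by blast
      then have "x \<notin> cl I" using B(3) False by (simp add: indep_def)
      then show False using x by simp
    qed
    then obtain y where y: "y \<in> I" "y \<notin> B" by blast
    then have "y \<notin> ?C" using B(1) by blast
    then have "x \<in> cl (I - {y})" using y(1) by (simp add: fund_circuit_def)
    then have "B \<subseteq> cl (I - {y})" using B(2) y(2) ext[of "I - {y}"] by blast
    then have "cl B \<subseteq> cl (I - {y})" by (rule cl_least)
    then have "y \<in> cl (I - {y})" using B(4) y(1) by blast
    then show False using I y(1) by (simp add: indep_def)
  qed
qed

text \<open>The elements of the circuit are indispensable, and by \<open>span_fund_circuit\<close>
  they suffice. In particular the subsets of \<open>I\<close> that span \<open>x\<close> are closed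
  under intersection, which \<open>augment\<close> uses.\<close>

lemma fund_circuit_subset_iff:
  assumes "indep cl I" "A \<subseteq> I" "x \<in> cl I"
  shows "x \<in> cl A \<longleftrightarrow> fund_circuit cl I x \<subseteq> A"
proof
  assume "x \<in> cl A"
  show "fund_circuit cl I x \<subseteq> A"
  proof
    fix y assume y: "y \<in> fund_circuit cl I x"
    show "y \<in> A"
    proof (rule ccontr)
      assume "y \<notin> A"
      then have "A \<subseteq> I - {y}" using assms(2) by blast
      then have "x \<in> cl (I - {y})" using \<open>x \<in> cl A\<close> mono by blast
      then show False using y by (simp add: fund_circuit_def)
    qed
  qed
next
  assume "fund_circuit cl I x \<subseteq> A"
  then show "x \<in> cl A" using span_fund_circuit[OF assms(1,3)] mono by blast
qed

text \<open>The pairs are exchanged one at a time. By the triangular last hypothesis the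
  \<open>u i\<close> brought in earlier lie in the closure of \<open>I - {y k}\<close>, so the
  current set without \<open>y k\<close> does not span \<open>u k\<close>, and \<open>u k\<close>
  can replace \<open>y k\<close>.\<close>

lemma exchange:
  fixes u y :: "nat \<Rightarrow> 'a"
  assumes "indep cl I"
    and "\<And>i. i < k \<Longrightarrow> u i \<notin> I" and "\<And>i. i < k \<Longrightarrow> y i \<in> I"
    and "\<And>i. i < k \<Longrightarrow> u i \<in> cl I" and "\<And>i. i < k \<Longrightarrow> u i \<notin> cl (I - {y i})"
    and "\<And>i j. i < j \<Longrightarrow> j < k \<Longrightarrow> u i \<in> cl (I - {y j})"
  shows "indep cl (I - y ` {..<k} \<union> u ` {..<k}) \<and> cl (I - y ` {..<k} \<union> u ` {..<k}) = cl I"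
  using assms(2-)
proof (induction k)
  case 0
  then show ?case using assms(1) by simp
next
  case (Suc k)
  define K where "K = I - y ` {..<k} \<union> u ` {..<k}"
  have IH: "indep cl K" "cl K = cl I" using Suc unfolding K_def by auto
  have yk: "y k \<noteq> y i" if "i < k" for i
  proof
    assume "y k = y i"
    then show False using Suc.prems(4)[of i] Suc.prems(5)[of i k] that by simp
  qed
  have yK: "y k \<in> K" using Suc.prems(2)[of k] yk unfolding K_def by auto
  have ynu: "y k \<notin> u ` {..<k}" using Suc.prems(1,2) by force
  have eq: "I - y ` {..<Suc k} \<union> u ` {..<Suc k} = insert (u k) (K - {y k})"
    using ynu unfolding K_def by (auto simp: lessThan_Suc)
  have "K - {y k} \<subseteq> cl (I - {y k})"
  proof
    fix v assume "v \<in> K - {y k}"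
    then consider "v \<in> I - {y k}" | i where "i < k" "v = u i" unfolding K_def by auto
    then show "v \<in> cl (I - {y k})"
      using ext[of "I - {y k}"] Suc.prems(5)[of _ k] by cases auto
  qed
  then have nu: "u k \<notin> cl (K - {y k})" using Suc.prems(4)[of k] cl_least by blast
  have ind: "indep cl (insert (u k) (K - {y k}))"
    using indep_insert[OF indep_subset[OF IH(1)] nu] by blast
  have "u k \<in> cl (insert (y k) (K - {y k}))"
    using Suc.prems(3)[of k] IH(2) yK by (simp add: insert_absorb)
  then have "y k \<in> cl (insert (u k) (K - {y k}))" using exch nu by blast
  then have "K \<subseteq> cl (insert (u k) (K - {y k}))" using ext[of "insert (u k) (K - {y k})"] by blast
  moreover have "insert (u k) (K - {y k}) \<subseteq> cl K"
    using ext[of K] Suc.prems(3)[of k] IH(2) by auto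
  ultimately have "cl (insert (u k) (K - {y k})) = cl K" by (intro cl_eqI)
  then show ?case unfolding eq using ind IH(2) by simp
qed

text \<open>Replace \<open>Y\<close> by a base \<open>C\<close> of it. A set independent over
  \<open>Y\<close> stays independent together with \<open>C\<close>, so bases of the contraction
  arise by extending in the original matroid and removing \<open>C\<close>.\<close>

lemma imatroid_contract: "imatroid (cl_contract cl Y)"
proof unfold_locales
  fix X Z :: "'a set" and x y :: 'a
  show "X \<subseteq> cl_contract cl Y X" unfolding cl_contract_def using ext by blast
  show "X \<subseteq> Z \<Longrightarrow> cl_contract cl Y X \<subseteq> cl_contract cl Y Z" unfolding cl_contract_def by (rule mono) blast
  show "cl_contract cl Y (cl_contract cl Y X) \<subseteq> cl_contract cl Y X"
    unfolding cl_contract_def using ext[of "X \<union> Y"] by (intro cl_least) blast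
  show "y \<in> cl_contract cl Y (insert x X) \<Longrightarrow> y \<notin> cl_contract cl Y X \<Longrightarrow> x \<in> cl_contract cl Y (insert y X)"
    unfolding cl_contract_def using exch[of y x "X \<union> Y"] by simp
next
  fix I X assume I: "indep (cl_contract cl Y) I" "I \<subseteq> X"
  obtain C where C: "C \<subseteq> Y" "indep cl C" "Y \<subseteq> cl C" using basis[of "{}" Y] by auto
  have clC: "cl (A \<union> Y) = cl (A \<union> C)" for A
    using C ext[of "A \<union> C"] ext[of "A \<union> Y"] mono[of C "A \<union> C"] by (intro cl_eqI) blast+
  have iff: "indep cl (A \<union> C)" if "indep (cl_contract cl Y) A" for A
    unfolding indep_def
  proof
    fix a assume a: "a \<in> A \<union> C"
    have A: "b \<notin> cl (A - {b} \<union> Y)" if "b \<in> A" for b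
      using \<open>indep (cl_contract cl Y) A\<close> that by (simp add: indep_def cl_contract_def)
    have disj: "A \<inter> C = {}" using A C(1) ext by blast
    show "a \<notin> cl (A \<union> C - {a})"
    proof (cases "a \<in> A")
      case True
      then have "A \<union> C - {a} \<subseteq> A - {a} \<union> Y" using C(1) by blast
      then show ?thesis using A[OF True] mono by blast
    next
      case False
      then have aC: "a \<in> C" using a by blast
      \<comment> \<open>If \<open>a\<close> were spanned, its circuit in \<open>D\<close> could not
        lie inside \<open>C - {a}\<close> and would contain some \<open>b\<close> of
        \<open>A\<close>. Exchanging \<open>b\<close> for \<open>a\<close> shows that
        \<open>b\<close> is spanned by \<open>Y\<close> and the rest of \<open>A\<close>.\<close>
      obtain D where D: "C - {a} \<subseteq> D" "D \<subseteq> A \<union> C - {a}" "indep cl D" "A \<union> C - {a} \<subseteq> cl D"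
        using basis[OF indep_subset[OF C(2)], of "C - {a}" "A \<union> C - {a}"] by blast
      show ?thesis
      proof
        assume as: "a \<in> cl (A \<union> C - {a})"
        then have aD: "a \<in> cl D" using cl_least[OF D(4)] by blast
        have "\<not> fund_circuit cl D a \<subseteq> C - {a}"
          using fund_circuit_subset_iff[OF D(3,1) aD] C(2) aC by (simp add: indep_def)
        then obtain b where b: "b \<in> D" "a \<notin> cl (D - {b})" "b \<in> A" using D(2) by (auto simp: fund_circuit_def)
        then have "b \<in> cl (insert a (D - {b}))"
          using exch[of a b "D - {b}"] aD by (simp add: insert_absorb)
        moreover have "insert a (D - {b}) \<subseteq> A - {b} \<union> Y" using D(2) aC C(1) disj b by blast
        ultimately show False using A[OF b(3)] mono by blast
      qed
    qed
  qed
  obtain B where B: "I \<union> C \<subseteq> B" "B \<subseteq> X \<union> C" "indep cl B" "X \<union> C \<subseteq> cl B"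
    using basis[OF iff[OF I(1)], of "X \<union> C"] I by blast
  have "indep (cl_contract cl Y) (B - C)"
    unfolding indep_def cl_contract_def
  proof
    fix a assume a: "a \<in> B - C"
    have "cl (B - C - {a} \<union> Y) = cl (B - {a})"
      unfolding clC using a B(1) by (intro arg_cong[where f = cl]) blast
    then show "a \<notin> cl (B - C - {a} \<union> Y)" using B(3) a by (simp add: indep_def)
  qed
  moreover have "I \<inter> C = {}"
    using I(1) C(1) ext unfolding indep_def cl_contract_def by blast
  moreover have "X \<subseteq> cl_contract cl Y (B - C)"
  proof -
    have "cl B \<subseteq> cl_contract cl Y (B - C)" unfolding cl_contract_def clC by (rule mono) blast
    then show ?thesis using B(4) by blast
  qed
  ultimately show "\<exists>B. I \<subseteq> B \<and> B \<subseteq> X \<and> indep (cl_contract cl Y) B \<and> X \<subseteq> cl_contract cl Y B"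
    using B by (intro exI[of _ "B - C"]) blast
qed

lemma indep_Un:
  assumes "indep cl A" "indep (cl_contract cl A) B"
  shows "indep cl (A \<union> B)"
proof -
  obtain D where D: "A \<subseteq> D" "D \<subseteq> A \<union> B" "indep cl D" "A \<union> B \<subseteq> cl D"
    using basis[OF assms(1), of "A \<union> B"] by blast
  have "B \<subseteq> D"
  proof
    fix b assume b: "b \<in> B"
    show "b \<in> D"
    proof (rule ccontr)
      assume "b \<notin> D"
      then have "D \<subseteq> B - {b} \<union> A" using D by blast
      then have "b \<in> cl (B - {b} \<union> A)" using D(4) b mono by blast
      then show False using assms(2) b by (simp add: indep_def cl_contract_def)
    qed
  qed
  then show ?thesis using D by (metis Un_subset_iff subset_antisym)
qed

lemma indep_contr_disj: "indep (cl_contract cl Y) A \<Longrightarrow> a \<in> A \<Longrightarrow> a \<notin> cl Y"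
  unfolding indep_def cl_contract_def using mono[of Y "A - {a} \<union> Y"] by blast

lemma indep_contr_mono: "indep (cl_contract cl Y) A \<Longrightarrow> Z \<subseteq> cl Y \<Longrightarrow> indep (cl_contract cl Z) A"
  unfolding indep_def cl_contract_def
proof
  fix a assume h: "\<forall>a\<in>A. a \<notin> cl (A - {a} \<union> Y)" "Z \<subseteq> cl Y" "a \<in> A"
  have "A - {a} \<union> Z \<subseteq> cl (A - {a} \<union> Y)"
    using h(2) ext[of "A - {a} \<union> Y"] mono[of Y "A - {a} \<union> Y"] by blast
  then show "a \<notin> cl (A - {a} \<union> Z)" using h cl_least by blast
qed

lemma indep_contr_indep: "indep (cl_contract cl Y) A \<Longrightarrow> indep cl A"
  using indep_contr_mono[of Y A "{}"] by (simp add: cl_contract_def[abs_def])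

lemma indep_contr_rest: 
  assumes "indep (cl_contract cl Y) I" "J \<subseteq> I"
  shows "indep (cl_contract cl (I - J \<union> Y)) J"
  unfolding indep_def cl_contract_def
proof
  fix a assume a: "a \<in> J"
  have "J - {a} \<union> (I - J \<union> Y) = I - {a} \<union> Y" using a assms(2) by auto
  then show "a \<notin> cl (J - {a} \<union> (I - J \<union> Y))"
    using assms a unfolding indep_def cl_contract_def by auto
qed

end

lemma contr_contr: "cl_contract (cl_contract f Y) Z = cl_contract f (Y \<union> Z)"
  by (rule ext) (simp add: cl_contract_def Un_ac)

lemma contr_empty [simp]: "cl_contract f {} = f"
  by (rule ext) (simp add: cl_contract_def)

section \<open>Augmenting paths\<close>

text \<open>The exchange digraph: sources are the elements outside \<open>g I\<close>, sinks those outside \<open>f I\<close>.\<close>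

definition arcs :: "('a set \<Rightarrow> 'a set) \<Rightarrow> ('a set \<Rightarrow> 'a set) \<Rightarrow> 'a set \<Rightarrow> ('a \<times> 'a) set" where
  "arcs f g I = {(u, y). u \<notin> I \<and> u \<in> f I \<and> y \<in> fund_circuit f I u} \<union>
                {(y, v). v \<notin> I \<and> v \<in> g I \<and> y \<in> fund_circuit g I v}"

locale matroid_pair = M: imatroid f + N: imatroid g for f g :: "'a set \<Rightarrow> 'a set"
begin

text \<open>Arcs of \<open>f\<close> lead from an element outside \<open>I\<close> to its circuit,
  so circuits of elements of \<open>Q\<close> stay in \<open>Q\<close>.\<close>

lemma closed_f:
  assumes "indep f I" "arcs f g I `` Q \<subseteq> Q" "Q \<subseteq> f I"
  shows "Q \<subseteq> f (I \<inter> Q)"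
proof
  fix u assume u: "u \<in> Q"
  show "u \<in> f (I \<inter> Q)"
  proof (cases "u \<in> I")
    case True
    then show ?thesis using u M.ext by blast
  next
    case False
    then have "fund_circuit f I u \<subseteq> Q" using assms(2,3) u unfolding arcs_def by blast
    then have "fund_circuit f I u \<subseteq> I \<inter> Q" by (auto simp: fund_circuit_def)
    then show ?thesis using M.fund_circuit_subset_iff[of I "I \<inter> Q" u] assms u by blast
  qed
qed

text \<open>Arcs of \<open>g\<close> run the other way, from the circuit to the element outside
  \<open>I\<close>, so circuits of elements outside \<open>Q\<close> avoid \<open>Q\<close>.\<close>

lemma closed_g:
  assumes "indep g I" "arcs f g I `` Q \<subseteq> Q" "v \<notin> Q" "v \<in> g I"
  shows "v \<in> g (I - Q)"
proof (cases "v \<in> I")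
  case True
  then show ?thesis using assms N.ext by blast
next
  case False
  then have "fund_circuit g I v \<inter> Q = {}" using assms unfolding arcs_def by blast
  then have "fund_circuit g I v \<subseteq> I - Q" by (auto simp: fund_circuit_def)
  then show ?thesis using N.fund_circuit_subset_iff[of I "I - Q" v] assms by blast
qed

end

text \<open>A shortcut or a repetition would shorten a path of least length. The absence of
  shortcuts supplies the triangular hypothesis of \<open>exchange\<close>.\<close>

lemma rtrancl_shortest:
  assumes "(x, z) \<in> r\<^sup>*"
  shows "\<exists>p n. p 0 = x \<and> p n = z \<and> (\<forall>i<n. (p i, p (Suc i)) \<in> r) \<and>
    (\<forall>i j. Suc i < j \<longrightarrow> j \<le> n \<longrightarrow> (p i, p j) \<notin> r) \<and>
    (\<forall>i j. i < j \<longrightarrow> j \<le> n \<longrightarrow> p i \<noteq> (p j :: 'a))"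
proof -
  define n where "n = (LEAST n. (x, z) \<in> r ^^ n)"
  have ex: "\<exists>n. (x, z) \<in> r ^^ n" using assms by (simp add: rtrancl_power)
  have n: "(x, z) \<in> r ^^ n" unfolding n_def by (rule LeastI_ex[OF ex])
  have least: "n \<le> m" if "(x, z) \<in> r ^^ m" for m using that unfolding n_def by (rule Least_le)
  obtain p where p: "p 0 = x" "p n = z" "\<And>i. i < n \<Longrightarrow> (p i, p (Suc i)) \<in> r"
    using n by (auto simp: relpow_fun_conv)
  have seg: "(p i, p j) \<in> r ^^ (j - i)" if "i \<le> j" "j \<le> n" for i j
    unfolding relpow_fun_conv
    by (rule exI[of _ "\<lambda>k. p (i + k)"]) (use that p(3) in auto)
  have short: "(p i, p j) \<notin> r" if "Suc i < j" "j \<le> n" for i j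
  proof
    assume "(p i, p j) \<in> r"
    then have "(p i, p j) \<in> r ^^ 1" by simp
    then have "(p 0, p n) \<in> r ^^ (i + 1 + (n - j))"
      using seg[of 0 i] seg[of j n] that unfolding relpow_add by auto
    then show False using least[of "i + 1 + (n - j)"] p that by simp
  qed
  have dist: "p i \<noteq> p j" if "i < j" "j \<le> n" for i j
  proof
    assume e: "p i = p j"
    then have "(p 0, p n) \<in> r ^^ (i + (n - j))"
      using seg[of 0 i] seg[of j n] that unfolding relpow_add by auto
    then show False using least[of "i + (n - j)"] p that by simp
  qed
  show ?thesis using p short dist by (intro exI[of _ p] exI[of _ n]) simp
qed

context matroid_pair
begin

text \<open>A shortest path alternates between elements outside \<open>I\<close>, which enter, and
  elements of \<open>I\<close>, which leave. For \<open>f\<close> each entering element but the last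
  replaces its successor, and \<open>z\<close> is added; for \<open>g\<close> each but the first
  replaces its predecessor, and \<open>x\<close> is added. The last conclusion records that
  arc-closed sets without sinks are left alone.\<close>

lemma augment:
  assumes I: "indep f I" "indep g I" and x: "x \<notin> g I" and z: "z \<notin> f I"
    and xz: "(x, z) \<in> (arcs f g I)\<^sup>*"
  obtains I' where "indep f I'" "indep g I'" "f I' = f (insert z I)" "g I' = g (insert x I)"
    "z \<in> I'" "finite (I - I')" "finite (I' - I)" "card (I' - I) = Suc (card (I - I'))"
    "\<forall>Q. arcs f g I `` Q \<subseteq> Q \<and> Q \<subseteq> f I \<longrightarrow> I' \<inter> Q = I \<inter> Q \<and> g (I - Q) \<subseteq> g (I' - Q)"
proof -
  obtain p n where p': "p 0 = x" "p n = z" "\<forall>i<n. (p i, p (Suc i)) \<in> arcs f g I"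
    "\<forall>i j. Suc i < j \<longrightarrow> j \<le> n \<longrightarrow> (p i, p j) \<notin> arcs f g I"
    "\<forall>i j. i < j \<longrightarrow> j \<le> n \<longrightarrow> p i \<noteq> p j"
    using rtrancl_shortest[OF xz] by (elim exE conjE)
  have p: "p 0 = x" "p n = z" "\<And>i. i < n \<Longrightarrow> (p i, p (Suc i)) \<in> arcs f g I"
    and short: "\<And>i j. Suc i < j \<Longrightarrow> j \<le> n \<Longrightarrow> (p i, p j) \<notin> arcs f g I"
    and dist: "\<And>i j. i < j \<Longrightarrow> j \<le> n \<Longrightarrow> p i \<noteq> p j"
    using p' by simp_all
  have xI: "x \<notin> I" and zI: "z \<notin> I" using x z M.ext[of I] N.ext[of I] by blast+
  have alt: "a \<in> I \<longleftrightarrow> b \<notin> I" if "(a, b) \<in> arcs f g I" for a b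
    using that unfolding arcs_def fund_circuit_def by auto
  have par: "i \<le> n \<Longrightarrow> p i \<in> I \<longleftrightarrow> odd i" for i
  proof (induction i)
    case 0 then show ?case using p(1) xI by simp
  next
    case (Suc i) then show ?case using alt[OF p(3)[of i]] by simp
  qed
  have "even n" using par[of n] p(2) zI by simp
  then obtain k where n: "n = 2 * k" by (elim evenE)
  define u where "u = (\<lambda>i. p (2 * i))"
  define y where "y = (\<lambda>i. p (2 * i + 1))"
  have uI: "u i \<notin> I" if "i \<le> k" for i using par[of "2 * i"] that n by (simp add: u_def)
  have yI: "y i \<in> I" if "i < k" for i using par[of "2 * i + 1"] that n by (simp add: y_def)
  have af: "u i \<in> f I" "u i \<notin> f (I - {y i})" if "i < k" for i
    using p(3)[of "2 * i"] that n uI[of i] yI[of i]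
    unfolding arcs_def fund_circuit_def u_def y_def by auto
  have ag: "u (Suc i) \<in> g I" "u (Suc i) \<notin> g (I - {y i})" if "i < k" for i
    using p(3)[of "2 * i + 1"] that n uI[of "Suc i"] yI[of i]
    unfolding arcs_def fund_circuit_def u_def y_def by auto
  have of: "u i \<in> f (I - {y j})" if "i < j" "j < k" for i j
  proof (rule ccontr)
    assume "u i \<notin> f (I - {y j})"
    then have "(u i, y j) \<in> arcs f g I"
      using af[of i] uI[of i] yI[of j] that unfolding arcs_def fund_circuit_def by auto
    then show False using short[of "2 * i" "2 * j + 1"] that n by (simp add: u_def y_def)
  qed
  have og: "u (Suc j) \<in> g (I - {y i})" if "i < j" "j < k" for i j
  proof (rule ccontr)
    assume "u (Suc j) \<notin> g (I - {y i})"
    then have "(y i, u (Suc j)) \<in> arcs f g I"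
      using ag[of j] uI[of "Suc j"] yI[of i] that unfolding arcs_def fund_circuit_def by auto
    then show False using short[of "2 * i + 1" "2 * Suc j"] that n by (simp add: u_def y_def)
  qed
  define U where "U = u ` {..k}"
  define Y where "Y = y ` {..<k}"
  define I' where "I' = I - Y \<union> U"
  have uk: "u k = z" "u 0 = x" using p n by (simp_all add: u_def)
  have U1: "U = insert z (u ` {..<k})"
    unfolding U_def uk(1)[symmetric] lessThan_Suc_atMost[symmetric] lessThan_Suc by simp
  have U2: "U = insert x (u ` Suc ` {..<k})"
    unfolding U_def uk(2)[symmetric]
    by (metis atMost_Suc_eq_insert_0 image_insert lessThan_Suc_atMost lessThan_Suc_eq_insert_0)
  have ef: "indep f (I - Y \<union> u ` {..<k}) \<and> f (I - Y \<union> u ` {..<k}) = f I"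
    unfolding Y_def using M.exchange[of I k u y] I(1) uI yI af of by simp
  \<comment> \<open>The absence of shortcuts keeps the circuit of \<open>u (Suc j)\<close> in
    \<open>g\<close> free of earlier \<open>y i\<close>, the opposite order to that in
    \<open>f\<close>. Reversing both sequences gives the order that \<open>exchange\<close> requires
    and pairs \<open>u (Suc i)\<close> with \<open>y i\<close>.\<close>
  define u' where "u' = (\<lambda>i. u (k - i))"
  define y' where "y' = (\<lambda>i. y (k - Suc i))"
  have rev: "(\<lambda>i. k - Suc i) ` {..<k} = {..<k}"
  proof
    show "{..<k} \<subseteq> (\<lambda>i. k - Suc i) ` {..<k}"
    proof
      fix i assume "i \<in> {..<k}"
      then have "i = k - Suc (k - Suc i)" "k - Suc i \<in> {..<k}" by auto
      then show "i \<in> (\<lambda>i. k - Suc i) ` {..<k}" by blast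
    qed
  qed auto
  have Y': "y' ` {..<k} = Y" unfolding Y_def y'_def by (metis rev image_image)
  have U': "u' ` {..<k} = u ` Suc ` {..<k}"
  proof -
    have "u' ` {..<k} = (\<lambda>i. u (Suc i)) ` (\<lambda>i. k - Suc i) ` {..<k}"
      unfolding u'_def image_image by (intro image_cong) (auto simp: Suc_diff_Suc)
    then show ?thesis unfolding rev by (simp add: image_image)
  qed
  have u'S: "u' i = u (Suc (k - Suc i))" if "i < k" for i
    using that by (simp add: u'_def Suc_diff_Suc)
  \<comment> \<open>Stated for a general \<open>J\<close> because it is applied to \<open>I\<close>
    and, for an arc-closed \<open>Q\<close>, to \<open>I - Q\<close>.\<close>
  have egg: "indep g (J - y' ` {..<k} \<union> u' ` {..<k}) \<and> g (J - y' ` {..<k} \<union> u' ` {..<k}) = g J"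
    if J: "J \<subseteq> I" "Y \<subseteq> J" "\<And>i. i < k \<Longrightarrow> u (Suc i) \<in> g J"
      "\<And>i j. i < j \<Longrightarrow> j < k \<Longrightarrow> u (Suc j) \<in> g (J - {y i})" for J
  proof (rule N.exchange)
    show "indep g J" using N.indep_subset[OF I(2) J(1)] .
    show "u' i \<notin> J" if "i < k" for i using J(1) uI[of "k - i"] that by (auto simp: u'_def)
    show "y' i \<in> J" if "i < k" for i using J(2) that Y' by blast
    show "u' i \<in> g J" if "i < k" for i using u'S[OF that] J(3)[of "k - Suc i"] that by simp
    show "u' i \<notin> g (J - {y' i})" if "i < k" for i
    proof -
      have "g (J - {y' i}) \<subseteq> g (I - {y' i})" using J(1) by (intro N.mono) blast
      then show ?thesis using u'S[OF that] ag(2)[of "k - Suc i"] that by (auto simp: y'_def)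
    qed
    show "u' i \<in> g (J - {y' j})" if "i < j" "j < k" for i j
      using u'S[of i] J(4)[of "k - Suc j" "k - Suc i"] that by (simp add: y'_def)
  qed
  have YI: "Y \<subseteq> I" using yI by (auto simp: Y_def)
  have eg: "indep g (I - Y \<union> u ` Suc ` {..<k}) \<and> g (I - Y \<union> u ` Suc ` {..<k}) = g I"
    using egg[of I] YI ag(1) og unfolding Y' U' by blast
  have If: "I' = insert z (I - Y \<union> u ` {..<k})" unfolding I'_def U1 by blast
  have Ig: "I' = insert x (I - Y \<union> u ` Suc ` {..<k})" unfolding I'_def U2 by blast
  have UI: "U \<inter> I = {}" using uI by (auto simp: U_def)
  have d: "I - I' = Y" "I' - I = U" using UI YI unfolding I'_def by blast+
  have "inj_on u {..k}"
  proof (rule inj_onI)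
    fix i j assume "i \<in> {..k}" "j \<in> {..k}" "u i = u j"
    then show "i = j" using dist[of "2 * i" "2 * j"] dist[of "2 * j" "2 * i"] n
      by (cases i j rule: linorder_cases) (auto simp: u_def)
  qed
  then have cU: "card U = Suc k" unfolding U_def by (simp add: card_image)
  have "inj_on y {..<k}"
  proof (rule inj_onI)
    fix i j assume "i \<in> {..<k}" "j \<in> {..<k}" "y i = y j"
    then show "i = j" using dist[of "2 * i + 1" "2 * j + 1"] dist[of "2 * j + 1" "2 * i + 1"] n
      by (cases i j rule: linorder_cases) (auto simp: y_def)
  qed
  then have cY: "card Y = k" unfolding Y_def by (simp add: card_image)
  show ?thesis
  proof (rule that[of I'])
    show "indep f I'" unfolding If using M.indep_insert ef z by metis
    show "indep g I'" unfolding Ig using N.indep_insert eg x by metis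
    show "f I' = f (insert z I)" unfolding If using M.cl_insert_cong ef by metis
    show "g I' = g (insert x I)" unfolding Ig using N.cl_insert_cong eg by metis
    show "z \<in> I'" unfolding If by blast
    show "finite (I - I')" "finite (I' - I)" unfolding d by (auto simp: U_def Y_def)
    show "card (I' - I) = Suc (card (I - I'))" unfolding d cU cY ..
    have "I' \<inter> Q = I \<inter> Q \<and> g (I - Q) \<subseteq> g (I' - Q)"
      if Q: "arcs f g I `` Q \<subseteq> Q" "Q \<subseteq> f I" for Q
    proof -
    \<comment> \<open>Induction from the end of the path: \<open>z\<close> is a sink and so not in
      \<open>Q\<close>, and a vertex in \<open>Q\<close> would force its successor into
      \<open>Q\<close>.\<close>
    have pQ: "i \<le> n \<Longrightarrow> p (n - i) \<notin> Q" for i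
    proof (induction i)
      case 0 then show ?case using p(2) z Q(2) by auto
    next
      case (Suc i)
      then have "(p (n - Suc i), p (n - i)) \<in> arcs f g I"
        using p(3)[of "n - Suc i"] by (simp add: Suc_diff_Suc)
      then show ?case using Suc Q(1) by (meson Image_singleton_iff ImageI Suc_leD subsetD)
    qed
    have pQ: "p i \<notin> Q" if "i \<le> n" for i using pQ[of "n - i"] that by simp
    have uQ: "u i \<notin> Q" if "i \<le> k" for i using pQ that n by (simp add: u_def)
    have yQ: "y i \<notin> Q" if "i < k" for i using pQ that n by (simp add: y_def)
    have YQ: "Y \<inter> Q = {}" "U \<inter> Q = {}" using uQ yQ by (auto simp: Y_def U_def)
    have uspan: "u (Suc i) \<in> g (I - Q)" if "i < k" for i
      using closed_g[OF I(2) Q(1)] uQ[of "Suc i"] ag(1)[OF that] that by simp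
    have uspan2: "u (Suc j) \<in> g (I - Q - {y i})" if "i < j" "j < k" for i j
    proof -
      have "fund_circuit g I (u (Suc j)) \<subseteq> I - Q - {y i}"
        using N.fund_circuit_subset_iff[OF I(2), of "I - Q" "u (Suc j)"]
          N.fund_circuit_subset_iff[OF I(2), of "I - {y i}" "u (Suc j)"] uspan[of j] og[OF that] ag(1)[of j] that
        by blast
      then show ?thesis
        using N.fund_circuit_subset_iff[OF I(2), of "I - Q - {y i}" "u (Suc j)"] ag(1)[of j] that by blast
    qed
    have "g (I - Q - Y \<union> u ` Suc ` {..<k}) = g (I - Q)"
      using egg[of "I - Q"] YI YQ uspan uspan2 unfolding Y' U' by blast
    moreover have "I - Q - Y \<union> u ` Suc ` {..<k} \<subseteq> I' - Q"
      using YQ unfolding I'_def U2 by blast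
    ultimately have "g (I - Q) \<subseteq> g (I' - Q)" using N.mono by blast
    moreover have "I' \<inter> Q = I \<inter> Q" using YQ unfolding I'_def by blast
    ultimately show ?thesis by blast
    qed
    then show "\<forall>Q. arcs f g I `` Q \<subseteq> Q \<and> Q \<subseteq> f I \<longrightarrow> I' \<inter> Q = I \<inter> Q \<and> g (I - Q) \<subseteq> g (I' - Q)"
      by blast
  qed
qed

text \<open>Let \<open>R\<close> be the set reachable from the sources. If it contains a sink, a
  path augments \<open>I\<close>; otherwise \<open>R\<close> is closed under arcs, and
  \<open>I\<close> and \<open>R\<close> form the certificate required by
  \<open>has_intersection\<close>.\<close>

lemma augment_or_optimal:
  assumes I: "indep f I" "indep g I"
  obtains (aug) x z I' where "x \<notin> g I" "z \<notin> f I" "z \<in> I'" "indep f I'" "indep g I'"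
    "f I' = f (insert z I)" "g I' = g (insert x I)"
    "finite (I - I')" "finite (I' - I)" "card (I' - I) = Suc (card (I - I'))"
  | (opt) R where "- g I \<subseteq> R" "R \<subseteq> f (I \<inter> R)" "- R \<subseteq> g (I - R)"
proof -
  define R where "R = (arcs f g I)\<^sup>* `` (- g I)"
  show ?thesis
  proof (cases "R \<subseteq> f I")
    case True
    have cl: "arcs f g I `` R \<subseteq> R" unfolding R_def by (auto intro: rtrancl_into_rtrancl)
    have sub: "- g I \<subseteq> R" unfolding R_def by blast
    then have "- R \<subseteq> g (I - R)" using closed_g[OF I(2) cl] by blast
    then show ?thesis using opt[OF sub closed_f[OF I(1) cl True]] by blast
  next
    case False
    then obtain x z where h: "x \<notin> g I" "z \<notin> f I" "(x, z) \<in> (arcs f g I)\<^sup>*" unfolding R_def by blast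
    show ?thesis
      by (rule augment[OF I h], rule aug[OF h(1,2)]) (assumption+)
  qed
qed

end

section \<open>Waves\<close>

text \<open>The set \<open>f A\<close> is a wave in the usual sense, with base \<open>A\<close>.\<close>

definition wave :: "('a set \<Rightarrow> 'a set) \<Rightarrow> ('a set \<Rightarrow> 'a set) \<Rightarrow> 'a set \<Rightarrow> bool" where
  "wave f g A \<longleftrightarrow> indep f A \<and> indep (cl_contract g (- f A)) A"

text \<open>The loops of \<open>f\<close> always form a wave, with base \<open>{}\<close>; in \<open>g\<close> they have to be spanned by the
  remaining elements.\<close>

definition nice :: "('a set \<Rightarrow> 'a set) \<Rightarrow> ('a set \<Rightarrow> 'a set) \<Rightarrow> bool" where
  "nice f g \<longleftrightarrow> (\<forall>A. wave f g A \<longrightarrow> A = {}) \<and> g (- f {}) = UNIV"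

text \<open>A wave \<open>A\<close> is independent in \<open>g\<close> contracted onto
  \<open>f A\<close>; the demand is that it is even a base there. A wave that fails this is known as
  a hindrance.\<close>

definition unhindered :: "('a set \<Rightarrow> 'a set) \<Rightarrow> ('a set \<Rightarrow> 'a set) \<Rightarrow> bool" where
  "unhindered f g \<longleftrightarrow> (\<forall>A. wave f g A \<longrightarrow> g (A \<union> - f A) = UNIV)"

context matroid_pair
begin

text \<open>Turns the certificate of \<open>augment_or_optimal\<close>, taken in \<open>g\<close>
  contracted by \<open>Y\<close>, into a wave: \<open>I \<inter> R\<close> is independent in
  \<open>g\<close> over \<open>I - R\<close> and \<open>Y\<close>, and these span everything outside
  \<open>f (I \<inter> R)\<close>.\<close>

lemma wave_reduce:
  assumes "indep f I" "indep (cl_contract g Y) I" "R \<subseteq> f (I \<inter> R)" "- R \<subseteq> g (I - R \<union> Y)"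
  shows "wave f g (I \<inter> R)"
  unfolding wave_def
proof
  show "indep f (I \<inter> R)" using M.indep_subset[OF assms(1)] by blast
  have "indep (cl_contract g (I - I \<inter> R \<union> Y)) (I \<inter> R)" using N.indep_contr_rest[OF assms(2)] by blast
  moreover have "I - I \<inter> R = I - R" by blast
  moreover have "- f (I \<inter> R) \<subseteq> g (I - R \<union> Y)" using assms(3,4) by blast
  ultimately show "indep (cl_contract g (- f (I \<inter> R))) (I \<inter> R)"
    using N.indep_contr_mono by metis
qed

text \<open>Zorn's lemma. Let \<open>a\<close> be in a member \<open>A\<close> of a chain of waves.
  As the union is independent in \<open>f\<close>, its elements outside \<open>A\<close> lie outside
  \<open>f A\<close>, so they were already contracted when \<open>A\<close> was tested as a
  wave.\<close>

lemma maximal_wave: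
  assumes "finitary f"
  obtains A where "wave f g A" "\<And>B. wave f g B \<Longrightarrow> A \<subseteq> B \<Longrightarrow> B = A"
proof -
  have "\<exists>A\<in>{A. wave f g A}. \<forall>B\<in>{A. wave f g A}. A \<subseteq> B \<longrightarrow> B = A"
  proof (rule subset_Zorn_nonempty)
    show "{A. wave f g A} \<noteq> {}"
      by (auto intro!: exI[of _ "{}"] simp: wave_def indep_def)
    fix C assume C: "C \<noteq> {}" "subset.chain {A. wave f g A} C"
    have w: "wave f g A" if "A \<in> C" for A using C(2) that by (auto simp: subset.chain_def)
    have lin: "A \<subseteq> B \<or> B \<subseteq> A" if "A \<in> C" "B \<in> C" for A B
      using C(2) that by (auto simp: subset.chain_def)
    have ind: "indep f (\<Union> C)"
      by (rule M.indep_chain_Union[OF assms lin]) (use w in \<open>auto simp: wave_def\<close>)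
    have "indep (cl_contract g (- f (\<Union> C))) (\<Union> C)"
      unfolding indep_def cl_contract_def
    proof
      fix a assume "a \<in> \<Union> C"
      then obtain A where A: "A \<in> C" "a \<in> A" by blast
      have sub: "A \<subseteq> \<Union> C" using A by blast
      have "\<Union> C - A \<subseteq> - f A"
      proof
        fix b assume b: "b \<in> \<Union> C - A"
        then have "A \<subseteq> \<Union> C - {b}" using sub by blast
        then show "b \<in> - f A" using ind b M.mono unfolding indep_def by blast
      qed
      then have "\<Union> C - {a} \<union> - f (\<Union> C) \<subseteq> A - {a} \<union> - f A" using M.mono[OF sub] A by blast
      moreover have "a \<notin> g (A - {a} \<union> - f A)"
        using w[OF A(1)] A(2) unfolding wave_def indep_def cl_contract_def by blast
      ultimately show "a \<notin> g (\<Union> C - {a} \<union> - f (\<Union> C))" using N.mono by blast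
    qed
    then show "\<Union> C \<in> {A. wave f g A}" using ind by (simp add: wave_def)
  qed
  then show ?thesis using that by blast
qed

text \<open>Contracting \<open>A\<close> in \<open>g\<close> only makes independence of
  \<open>B\<close> harder, so the first alternative reduces to the second. Both \<open>B\<close> and
  the complement of \<open>f (A \<union> B)\<close> lie outside \<open>f A\<close>, so
  \<open>A\<close> is independent in \<open>g\<close> over them. The second alternative serves pairs
  in which \<open>g\<close> is restricted.\<close>

lemma wave_extend:
  assumes "wave f g A" "wave (cl_contract f A) (cl_contract g A) B \<or> wave (cl_contract f A) g B"
  shows "wave f g (A \<union> B)"
  unfolding wave_def
proof
  have A: "indep f A" "indep (cl_contract g (- f A)) A" using assms(1) by (auto simp: wave_def)
  have B: "indep (cl_contract f A) B" "indep (cl_contract g (- f (A \<union> B))) B"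
  proof -
    show "indep (cl_contract f A) B" using assms(2) by (auto simp: wave_def)
    have "- cl_contract f A B = - f (A \<union> B)" by (simp add: cl_contract_def Un_commute)
    then have "indep (cl_contract g (A \<union> - f (A \<union> B))) B \<or> indep (cl_contract g (- f (A \<union> B))) B"
      using assms(2) by (auto simp: wave_def contr_contr)
    then show "indep (cl_contract g (- f (A \<union> B))) B"
      using N.indep_contr_mono N.ext by (meson Un_upper2 subset_trans)
  qed
  show "indep f (A \<union> B)" by (rule M.indep_Un[OF A(1) B(1)])
  have disj: "B \<subseteq> - f A" using imatroid.indep_contr_disj[OF M.imatroid_axioms B(1)] by blast
  have "indep (cl_contract g (- f (A \<union> B) \<union> B)) A"
    by (rule N.indep_contr_mono[OF A(2)])
      (use disj N.ext[of "- f A"] M.mono[of A "A \<union> B"] in blast)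
  then have "indep (cl_contract (cl_contract g (- f (A \<union> B))) B) A" by (simp add: contr_contr)
  then show "indep (cl_contract g (- f (A \<union> B))) (A \<union> B)"
    using imatroid.indep_Un[OF N.imatroid_contract B(2)] by (simp add: Un_commute)
qed

text \<open>A nonempty wave of the contracted pair would enlarge a maximal wave; unhinderedness
  applied to that maximal wave is the loop condition of \<open>nice\<close>.\<close>

lemma nice_extension:
  assumes "unhindered f g" "finitary f"
  obtains A where "wave f g A" "nice (cl_contract f A) (cl_contract g A)"
proof -
  obtain A where A: "wave f g A" "\<And>B. wave f g B \<Longrightarrow> A \<subseteq> B \<Longrightarrow> B = A"
    using maximal_wave[OF assms(2)] by blast
  have "nice (cl_contract f A) (cl_contract g A)"
    unfolding nice_def
  proof (intro conjI allI impI)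
    fix B assume B: "wave (cl_contract f A) (cl_contract g A) B"
    then have "A \<union> B = A" using A(2)[of "A \<union> B"] wave_extend[OF A(1), of B] by blast
    moreover have "B \<inter> A = {}"
      using M.indep_contr_disj[of A B] M.ext[of A] B unfolding wave_def by blast
    ultimately show "B = {}" by blast
  next
    show "cl_contract g A (- cl_contract f A {}) = UNIV"
      using assms(1) A(1) unfolding unhindered_def cl_contract_def by (simp add: Un_commute)
  qed
  then show ?thesis using that A(1) by blast
qed

text \<open>If no augmentation exists, the certificate yields a wave, which is empty. Then
  \<open>R\<close> consists of loops of \<open>f\<close>, so \<open>I\<close> and \<open>Y\<close>
  span all other elements in \<open>g\<close>, and by \<open>nice\<close> everything.\<close>

lemma nice_augment:
  assumes n: "nice f g" and I: "indep f I" "indep (cl_contract g Y) I" and sp: "g (I \<union> Y) \<noteq> UNIV"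
  obtains z I' where "z \<notin> f I" "z \<in> I'" "indep f I'" "indep (cl_contract g Y) I'"
    "f I' = f (insert z I)" "finite (I - I')" "finite (I' - I)" "card (I' - I) = Suc (card (I - I'))"
proof -
  interpret C: matroid_pair f "cl_contract g Y"
    by (intro matroid_pair.intro M.imatroid_axioms N.imatroid_contract)
  show ?thesis
  proof (rule C.augment_or_optimal[OF I])
    fix x z I' assume "x \<notin> cl_contract g Y I" "z \<notin> f I" "z \<in> I'" "indep f I'" "indep (cl_contract g Y) I'"
      "f I' = f (insert z I)" "cl_contract g Y I' = cl_contract g Y (insert x I)"
      "finite (I - I')" "finite (I' - I)" "card (I' - I) = Suc (card (I - I'))"
    then show ?thesis using that by blast
  next
    fix R assume R: "- cl_contract g Y I \<subseteq> R" "R \<subseteq> f (I \<inter> R)" "- R \<subseteq> cl_contract g Y (I - R)"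
    have "wave f g (I \<inter> R)" by (rule wave_reduce[OF I R(2)]) (use R(3) in \<open>simp add: cl_contract_def\<close>)
    then have "I \<inter> R = {}" using n unfolding nice_def by blast
    then have "- f {} \<subseteq> g (I - R \<union> Y)" using R by (auto simp: cl_contract_def)
    then have "- f {} \<subseteq> g (I \<union> Y)" using N.mono[of "I - R \<union> Y" "I \<union> Y"] by blast
    then have "g (- f {}) \<subseteq> g (I \<union> Y)" by (rule N.cl_least)
    then have False using n sp unfolding nice_def by blast
    then show ?thesis ..
  qed
qed

text \<open>If a wave \<open>A\<close> of the contracted pair fails to span,
  \<open>nice_augment\<close> enlarges it. The new element \<open>z'\<close> lies in
  \<open>f (insert z A)\<close>, so the result has the closure of \<open>insert z A\<close> and is a
  nonempty wave of the nice pair.\<close>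

lemma nice_imp_unhindered_contr:
  assumes n: "nice f g"
  shows "unhindered (cl_contract f {z}) (cl_contract g {x})"
  unfolding unhindered_def
proof (intro allI impI)
  fix A assume A: "wave (cl_contract f {z}) (cl_contract g {x}) A"
  define Y where "Y = - f (insert z A)"
  have A1: "indep (cl_contract f {z}) A" and A2: "indep (cl_contract (cl_contract g {x}) Y) A"
    using A unfolding wave_def Y_def by (auto simp: cl_contract_def)
  have fA: "indep f A" using M.indep_contr_indep[OF A1] .
  have gA: "indep (cl_contract g Y) A"
    using A2 N.indep_contr_mono[of "{x} \<union> Y" A Y] N.ext[of "{x} \<union> Y"] by (auto simp: contr_contr)
  have sp: "g (A \<union> Y) = UNIV"
  proof (rule ccontr)
    assume "g (A \<union> Y) \<noteq> UNIV"
    then obtain z' I' where z': "z' \<notin> f A" "z' \<in> I'" "indep f I'" "indep (cl_contract g Y) I'"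
      "f I' = f (insert z' A)" using nice_augment[OF n fA gA] by metis
    have "z' \<notin> Y" using N.indep_contr_disj[OF z'(4,2)] N.ext[of Y] by blast
    then have z'A: "z' \<in> f (insert z A)" by (simp add: Y_def)
    then have "z \<in> f (insert z' A)" using M.exch z'(1) by blast
    then have "f (insert z' A) = f (insert z A)"
      using z'A M.ext[of "insert z A"] M.ext[of "insert z' A"] by (intro M.cl_eqI) auto
    then have "wave f g I'" using z' unfolding wave_def Y_def by simp
    then show False using n z'(2) unfolding nice_def by blast
  qed
  have "- cl_contract f {z} A = Y" by (simp add: Y_def cl_contract_def)
  then show "cl_contract g {x} (A \<union> - cl_contract f {z} A) = UNIV"
    using sp N.mono[of "A \<union> Y" "A \<union> Y \<union> {x}"] by (auto simp: cl_contract_def)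
qed

end

section \<open>Two finitary matroids\<close>

definition feasible :: "('a set \<Rightarrow> 'a set) \<Rightarrow> ('a set \<Rightarrow> 'a set) \<Rightarrow> 'a set \<Rightarrow> bool" where
  "feasible f g J \<longleftrightarrow> indep f J \<and> indep g J \<and> nice (cl_contract f J) (cl_contract g J)"

lemma (in imatroid) finitary_contract: "finitary cl \<Longrightarrow> finitary (cl_contract cl Y)"
  unfolding finitary_def cl_contract_def
proof (intro allI ballI)
  fix X x assume "\<forall>X. \<forall>x\<in>cl X. \<exists>F\<subseteq>X. finite F \<and> x \<in> cl F" "x \<in> cl (X \<union> Y)"
  then obtain F where F: "F \<subseteq> X \<union> Y" "finite F" "x \<in> cl F" by blast
  have "F \<subseteq> F \<inter> X \<union> Y" using F(1) by blast
  then have "x \<in> cl (F \<inter> X \<union> Y)" using mono F(3) by blast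
  then show "\<exists>F\<subseteq>X. finite F \<and> x \<in> cl (F \<union> Y)"
    using F(2) by (intro exI[of _ "F \<inter> X"]) simp
qed

section \<open>Growing feasible sets\<close>

context matroid_pair
begin

lemma matroid_pair_contr: "matroid_pair (cl_contract f Y) (cl_contract g Z)"
  by (intro matroid_pair.intro M.imatroid_contract N.imatroid_contract)

lemma feasible_extend:
  assumes I: "indep f I" "indep g I" and u: "unhindered (cl_contract f I) (cl_contract g I)" and fin: "finitary f"
  obtains A where "feasible f g (I \<union> A)" "A \<inter> f I = {}"
proof -
  interpret C: matroid_pair "cl_contract f I" "cl_contract g I" by (rule matroid_pair_contr)
  obtain A where A: "wave (cl_contract f I) (cl_contract g I) A" "nice (cl_contract (cl_contract f I) A) (cl_contract (cl_contract g I) A)"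
    using C.nice_extension[OF u M.finitary_contract[OF fin]] by blast
  have fA: "indep (cl_contract f I) A" and gA: "indep (cl_contract g I) A"
    using A(1) C.N.indep_contr_indep unfolding wave_def by blast+
  have "feasible f g (I \<union> A)"
    unfolding feasible_def
    using M.indep_Un[OF I(1) fA] N.indep_Un[OF I(2) gA] A(2) by (simp add: contr_contr)
  moreover have "A \<inter> f I = {}" using M.indep_contr_disj[OF fA] by blast
  ultimately show ?thesis using that by blast
qed

lemma feasible_Un:
  assumes "feasible f g I" "feasible (cl_contract f I) (cl_contract g I) J"
  shows "feasible f g (I \<union> J)"
  unfolding feasible_def
proof (intro conjI)
  show "indep f (I \<union> J)" "indep g (I \<union> J)"
    using assms M.indep_Un N.indep_Un unfolding feasible_def by blast+
  show "nice (cl_contract f (I \<union> J)) (cl_contract g (I \<union> J))"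
    using assms(2) unfolding feasible_def contr_contr by blast
qed

text \<open>Contracting the augmented set amounts to contracting \<open>J\<close> and then
  \<open>z\<close> in \<open>f\<close> and \<open>x\<close> in \<open>g\<close>. This leaves an
  unhindered pair, which a maximal wave makes nice again. The wave avoids \<open>f J\<close>, hence
  every \<open>Q\<close> of the last conclusion.\<close>

lemma feasible_augment:
  assumes J: "feasible f g J" and fin: "finitary f"
    and x: "x \<notin> g J" and z: "z \<notin> f J" and xz: "(x, z) \<in> (arcs f g J)\<^sup>*"
  obtains J' where "feasible f g J'" "f J \<subseteq> f J'" "g (insert x J) \<subseteq> g J'"
    "\<forall>Q. arcs f g J `` Q \<subseteq> Q \<and> Q \<subseteq> f J \<longrightarrow> J' \<inter> Q = J \<inter> Q \<and> g (J - Q) \<subseteq> g (J' - Q)"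
proof -
  have Ji: "indep f J" "indep g J" and n: "nice (cl_contract f J) (cl_contract g J)"
    using J by (auto simp: feasible_def)
  obtain I' where I': "indep f I'" "indep g I'" "f I' = f (insert z J)" "g I' = g (insert x J)"
    and Q: "\<forall>Q. arcs f g J `` Q \<subseteq> Q \<and> Q \<subseteq> f J \<longrightarrow> I' \<inter> Q = J \<inter> Q \<and> g (J - Q) \<subseteq> g (I' - Q)"
    by (rule augment[OF Ji x z xz])
  interpret C: matroid_pair "cl_contract f J" "cl_contract g J" by (rule matroid_pair_contr)
  have "cl_contract (cl_contract f J) {z} = cl_contract f I'" "cl_contract (cl_contract g J) {x} = cl_contract g I'"
    unfolding contr_contr cl_contract_def
    using M.cl_Un_cong[OF I'(3)] N.cl_Un_cong[OF I'(4)] by auto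
  then have "unhindered (cl_contract f I') (cl_contract g I')"
    using C.nice_imp_unhindered_contr[OF n, of z x] by simp
  then obtain A where A: "feasible f g (I' \<union> A)" "A \<inter> f I' = {}"
    using feasible_extend[OF I'(1,2) _ fin] by blast
  have fJ: "f J \<subseteq> f I'" unfolding I'(3) by (rule M.mono) blast
  show ?thesis
  proof (rule that[OF A(1)])
    show "f J \<subseteq> f (I' \<union> A)" using fJ M.mono[of I' "I' \<union> A"] by blast
    show "g (insert x J) \<subseteq> g (I' \<union> A)" unfolding I'(4)[symmetric] by (rule N.mono) blast
    have stable: "(I' \<union> A) \<inter> Q = J \<inter> Q \<and> g (J - Q) \<subseteq> g ((I' \<union> A) - Q)"
      if q: "arcs f g J `` Q \<subseteq> Q" "Q \<subseteq> f J" for Q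
    proof -
      have "A \<inter> Q = {}" using q A(2) fJ by blast
      then have "I' - Q \<subseteq> (I' \<union> A) - Q" "(I' \<union> A) \<inter> Q = I' \<inter> Q" by blast+
      moreover have "I' \<inter> Q = J \<inter> Q" "g (J - Q) \<subseteq> g (I' - Q)" using spec[OF Q, of Q] q by simp_all
      ultimately show ?thesis using N.mono[of "I' - Q" "I' \<union> A - Q"] by simp
    qed
    then show "\<forall>Q. arcs f g J `` Q \<subseteq> Q \<and> Q \<subseteq> f J \<longrightarrow>
        (I' \<union> A) \<inter> Q = J \<inter> Q \<and> g (J - Q) \<subseteq> g ((I' \<union> A) - Q)"
      by (intro allI impI, elim conjE) (rule stable)
  qed
qed

text \<open>Circuits in \<open>f\<close> of elements of \<open>Q\<close> stay in \<open>Q\<close>,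
  where \<open>J\<close> and \<open>J'\<close> agree. For an arc of \<open>g\<close>, if
  \<open>J' - {a}\<close> spanned \<open>b\<close>, it would span \<open>insert b (J - {a})\<close>
  and hence \<open>a\<close>, against the independence of \<open>J'\<close>.\<close>

lemma arcs_persist:
  assumes J: "indep f J" "indep g J" and J': "indep f J'" "indep g J'"
    and Q: "arcs f g J `` Q \<subseteq> Q" "Q \<subseteq> f J"
    and stable: "J' \<inter> Q = J \<inter> Q" "f J \<subseteq> f J'" "g J \<subseteq> g J'" "g (J - Q) \<subseteq> g (J' - Q)"
    and ab: "(a, b) \<in> arcs f g J" "a \<in> Q"
  shows "(a, b) \<in> arcs f g J'"
proof -
  have bQ: "b \<in> Q" using Q(1) ab by blast
  consider (1) "a \<notin> J" "a \<in> f J" "b \<in> fund_circuit f J a" | (2) "b \<notin> J" "b \<in> g J" "a \<in> fund_circuit g J b"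
    using ab(1) unfolding arcs_def by auto
  then show ?thesis
  proof cases
    case 1
    have aJ': "a \<notin> J'" "a \<in> f J'" using 1 stable(1,2) ab(2) by blast+
    have "fund_circuit f J a \<subseteq> Q" using Q(1) 1 ab(2) unfolding arcs_def by blast
    then have sub: "fund_circuit f J a \<subseteq> J'" using stable(1) by (auto simp: fund_circuit_def)
    have "b \<in> fund_circuit f J' a"
    proof (rule ccontr)
      assume n: "b \<notin> fund_circuit f J' a"
      have "a \<in> f (fund_circuit f J a)" using M.span_fund_circuit[OF J(1) 1(2)] .
      then have "fund_circuit f J' a \<subseteq> fund_circuit f J a" using M.fund_circuit_subset_iff[OF J'(1) sub aJ'(2)] by blast
      then have "fund_circuit f J' a \<subseteq> J - {b}" using n by (auto simp: fund_circuit_def)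
      then have "a \<in> f (J - {b})" using M.span_fund_circuit[OF J'(1) aJ'(2)] M.mono by blast
      then show False using 1(3) by (simp add: fund_circuit_def)
    qed
    then show ?thesis using aJ' by (simp add: arcs_def)
  next
    case 2
    have bJ': "b \<notin> J'" "b \<in> g J'" using 2 stable(1,3) bQ by blast+
    have aJ: "a \<in> J" "b \<notin> g (J - {a})" using 2(3) by (auto simp: fund_circuit_def)
    have aJ': "a \<in> J'" using aJ(1) ab(2) stable(1) by blast
    have "b \<notin> g (J' - {a})"
    proof
      assume b: "b \<in> g (J' - {a})"
      have "J' - Q \<subseteq> J' - {a}" using ab(2) by blast
      then have "g (J - Q) \<subseteq> g (J' - {a})" using stable(4) N.mono by blast
      moreover have "(J - {a}) \<inter> Q \<subseteq> g (J' - {a})" using stable(1) N.ext[of "J' - {a}"] by blast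
      ultimately have "insert b (J - {a}) \<subseteq> g (J' - {a})" using b N.ext[of "J - Q"] by blast
      then have sub: "g (insert b (J - {a})) \<subseteq> g (J' - {a})" by (rule N.cl_least)
      have "b \<in> g (insert a (J - {a}))" using 2(2) aJ(1) by (simp add: insert_absorb)
      then have "a \<in> g (insert b (J - {a}))" using N.exch aJ(2) by blast
      then show False using sub J'(2) aJ' unfolding indep_def by blast
    qed
    then show ?thesis using bJ' aJ' by (simp add: arcs_def fund_circuit_def)
  qed
qed

text \<open>Each element of \<open>ready J\<close> can be spanned by a single augmentation of \<open>J\<close>. In
  \<open>nice_spannable\<close> the least ready element (in a fixed enumeration) is served at every step, so an
  element \<open>x\<close> is overtaken only finitely often. If \<open>x\<close> is never served, then from some step on no
  sink is reachable from it, the set reachable from \<open>x\<close> only grows, and \<open>J\<close> does not change on that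
  set. The limit of \<open>J\<close> on these sets is a nonempty wave.\<close>

definition ready :: "'a set \<Rightarrow> 'a set" where
  "ready J = {x. x \<notin> g J \<and> \<not> (arcs f g J)\<^sup>* `` {x} \<subseteq> f J}"

lemma nice_spannable:
  assumes n: "nice f g" and finf: "finitary f" and fing: "finitary g" and count: "countable (- g {})"
  shows "\<exists>J. feasible f g J \<and> e \<in> g J"
proof (rule ccontr)
  assume neg: "\<nexists>J. feasible f g J \<and> e \<in> g J"
  \<comment> \<open>Ready elements are not loops of \<open>g\<close>, so an index that is injective
    on the non-loops distinguishes them.\<close>
  define idx where "idx = to_nat_on (- g {})"
  have inj: "inj_on idx (- g {})" unfolding idx_def using count by (rule inj_on_to_nat_on)
  define step where "step J J' \<longleftrightarrow> f J \<subseteq> f J' \<and> g J \<subseteq> g J' \<and>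
     (\<forall>Q. arcs f g J `` Q \<subseteq> Q \<and> Q \<subseteq> f J \<longrightarrow> J' \<inter> Q = J \<inter> Q \<and> g (J - Q) \<subseteq> g (J' - Q)) \<and>
     (ready J \<noteq> {} \<longrightarrow> (\<exists>x\<in>ready J. x \<in> g J' \<and> (\<forall>y\<in>ready J. idx x \<le> idx y)))" for J J'
  have ex: "\<exists>J'. feasible f g J' \<and> step J J'" if J: "feasible f g J" for J
  proof (cases "ready J = {}")
    case True
    then show ?thesis using J unfolding step_def by blast
  next
    case False
    then obtain x0 where x0: "x0 \<in> ready J" by blast
    define x where "x = arg_min idx (\<lambda>y. y \<in> ready J)"
    have x: "x \<in> ready J" "\<And>y. y \<in> ready J \<Longrightarrow> idx x \<le> idx y"
    proof -
      have m: "is_arg_min idx (\<lambda>y. y \<in> ready J) x"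
        unfolding x_def by (rule is_arg_min_arg_min_nat) (rule x0)
      then show "x \<in> ready J" by (simp add: is_arg_min_def)
      show "idx x \<le> idx y" if "y \<in> ready J" for y using m that by (simp add: is_arg_min_linorder)
    qed
    obtain z where z: "x \<notin> g J" "z \<notin> f J" "(x, z) \<in> (arcs f g J)\<^sup>*"
      using x(1) unfolding ready_def by blast
    obtain J' where J': "feasible f g J'" "f J \<subseteq> f J'" "g (insert x J) \<subseteq> g J'"
      "\<forall>Q. arcs f g J `` Q \<subseteq> Q \<and> Q \<subseteq> f J \<longrightarrow> J' \<inter> Q = J \<inter> Q \<and> g (J - Q) \<subseteq> g (J' - Q)"
      by (rule feasible_augment[OF J finf z])
    have "g J \<subseteq> g J'" "x \<in> g J'" using J'(3) N.mono[of J "insert x J"] N.ext[of "insert x J"] by blast+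
    then have "step J J'" unfolding step_def using J' x by blast
    then show ?thesis using J'(1) by blast
  qed
  have "feasible f g {}" using n by (simp add: feasible_def)
  then obtain J where Jf: "\<And>n. feasible f g (J n)" and st: "\<And>n. step (J n) (J (Suc n))"
    using dependent_nat_choice[of "\<lambda>_. feasible f g" "\<lambda>_. step"] ex by blast
  have sf: "f (J n) \<subseteq> f (J (Suc n))" for n
    using st[of n] unfolding step_def by (elim conjE)
  have sg: "g (J n) \<subseteq> g (J (Suc n))" for n
    using st[of n] unfolding step_def by (elim conjE)
  have sQ: "\<forall>Q. arcs f g (J n) `` Q \<subseteq> Q \<and> Q \<subseteq> f (J n) \<longrightarrow>
      J (Suc n) \<inter> Q = J n \<inter> Q \<and> g (J n - Q) \<subseteq> g (J (Suc n) - Q)" for n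
    using st[of n] unfolding step_def by (elim conjE)
  have sr: "ready (J n) \<noteq> {} \<longrightarrow>
      (\<exists>x\<in>ready (J n). x \<in> g (J (Suc n)) \<and> (\<forall>y\<in>ready (J n). idx x \<le> idx y))" for n
    using st[of n] unfolding step_def by (elim conjE)
  have Ji: "indep f (J n)" "indep g (J n)" for n using Jf[of n] by (auto simp: feasible_def)
  have gmono: "m \<le> n \<Longrightarrow> g (J m) \<subseteq> g (J n)" for m n
    by (rule lift_Suc_mono_le[of "\<lambda>n. g (J n)"]) (rule sg)
  define T where "T = (\<Union>n. g (J n))"
  have Tcl: "g T \<subseteq> T"
  proof
    fix x assume "x \<in> g T"
    then obtain F where F: "F \<subseteq> T" "finite F" "x \<in> g F" using finitaryD[OF fing] by blast
    have "\<exists>n. F \<subseteq> g (J n)" using F(2,1)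
    proof induction
      case (insert a F)
      then obtain n where "F \<subseteq> g (J n)" by blast
      moreover obtain m where "a \<in> g (J m)" using insert unfolding T_def by blast
      ultimately have "insert a F \<subseteq> g (J (max m n))" using gmono[of n "max m n"] gmono[of m "max m n"] by auto
      then show ?case by blast
    qed simp
    then show "x \<in> T" using F(3) N.cl_mem unfolding T_def by blast
  qed
  define X where "X = - T"
  have eX: "e \<in> X" using neg Jf unfolding X_def T_def by blast
  \<comment> \<open>Whenever \<open>x\<close> is ready, an element of index at most
    \<open>idx x\<close> is served. Served elements remain spanned and are not served again, so this
    happens finitely often.\<close>
  have bounded: "\<exists>n. \<forall>m\<ge>n. x \<notin> ready (J m)" if x: "x \<in> X" for x
  proof -
    define S where "S = {m. x \<in> ready (J m)}"
    have "\<forall>m\<in>S. \<exists>y. y \<in> ready (J m) \<and> y \<in> g (J (Suc m)) \<and> idx y \<le> idx x"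
    proof
      fix m assume "m \<in> S"
      then have x: "x \<in> ready (J m)" by (simp add: S_def)
      then obtain y where "y \<in> ready (J m)" "y \<in> g (J (Suc m))" "\<forall>z\<in>ready (J m). idx y \<le> idx z"
        using sr[of m] by blast
      then show "\<exists>y. y \<in> ready (J m) \<and> y \<in> g (J (Suc m)) \<and> idx y \<le> idx x" using x by blast
    qed
    from bchoice[OF this]
    obtain y where "\<forall>m\<in>S. y m \<in> ready (J m) \<and> y m \<in> g (J (Suc m)) \<and> idx (y m) \<le> idx x" ..
    then have y: "y m \<in> ready (J m)" "y m \<in> g (J (Suc m))" "idx (y m) \<le> idx x" if "m \<in> S" for m
      using that by blast+
    have yn: "y m \<notin> g (J m)" if "m \<in> S" for m using y(1)[OF that] by (simp add: ready_def)
    have lt: "y m \<noteq> y k" if "m \<in> S" "k \<in> S" "m < k" for m k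
      using y(2)[OF that(1)] yn[OF that(2)] gmono[of "Suc m" k] that by auto
    have "inj_on (\<lambda>m. idx (y m)) S"
    proof (rule inj_onI)
      fix m k assume mk: "m \<in> S" "k \<in> S" "idx (y m) = idx (y k)"
      have "y m \<notin> g {}" "y k \<notin> g {}" using yn mk N.mono[of "{}"] by blast+
      then have "y m = y k" using mk(3) inj by (auto dest: inj_onD)
      then show "m = k" using lt[of m k] lt[of k m] mk by (cases m k rule: linorder_cases) auto
    qed
    moreover have "(\<lambda>m. idx (y m)) ` S \<subseteq> {..idx x}" using y(3) by auto
    ultimately have "finite S" by (meson finite_atMost finite_imageD finite_subset)
    then obtain b where b: "\<forall>m\<in>S. m \<le> b" unfolding finite_nat_set_iff_bounded_le by blast
    have "\<forall>m\<ge>Suc b. x \<notin> ready (J m)" using b unfolding S_def by (metis mem_Collect_eq not_less_eq_eq)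
    then show ?thesis by blast
  qed
  \<comment> \<open>The elements of \<open>X' n\<close> are never spanned and reach no sink from
    step \<open>n\<close> on; \<open>Q n\<close> below is the set they reach.\<close>
  define X' where "X' n = {x\<in>X. \<forall>m\<ge>n. x \<notin> ready (J m)}" for n
  have X'm: "X' n \<subseteq> X' (Suc n)" for n unfolding X'_def by auto
  have X'X: "X = (\<Union>n. X' n)" using bounded unfolding X'_def by blast
  define Q where "Q n = (arcs f g (J n))\<^sup>* `` X' n" for n
  have Qcl: "arcs f g (J n) `` Q n \<subseteq> Q n" for n unfolding Q_def by (auto intro: rtrancl_into_rtrancl)
  have Qf: "Q n \<subseteq> f (J n)" for n
  proof
    fix b assume "b \<in> Q n"
    then obtain x where x: "x \<in> X' n" "b \<in> (arcs f g (J n))\<^sup>* `` {x}" unfolding Q_def by blast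
    then have "x \<notin> ready (J n)" "x \<notin> g (J n)" unfolding X'_def X_def T_def by auto
    then show "b \<in> f (J n)" using x(2) unfolding ready_def by blast
  qed
  have XQ: "X' n \<subseteq> Q n" for n unfolding Q_def by blast
  have stab: "J (Suc n) \<inter> Q n = J n \<inter> Q n" "g (J n - Q n) \<subseteq> g (J (Suc n) - Q n)" for n
    using mp[OF spec[OF sQ] conjI[OF Qcl Qf]] by (rule conjunct1, rule conjunct2)
  have Qm: "Q n \<subseteq> Q (Suc n)" for n
  proof
    fix b assume "b \<in> Q n"
    then obtain x where x: "x \<in> X' n" "(x, b) \<in> (arcs f g (J n))\<^sup>*" unfolding Q_def by blast
    from x(2) have "(x, b) \<in> (arcs f g (J (Suc n)))\<^sup>*"
    proof induction
      case (step b c)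
      have "b \<in> Q n" using x(1) step(1) unfolding Q_def by blast
      then have "(b, c) \<in> arcs f g (J (Suc n))"
        by (rule arcs_persist[OF Ji[of n] Ji[of "Suc n"] Qcl Qf stab(1) sf sg stab(2) step(2)])
      then show ?case using step.IH by (rule rtrancl_into_rtrancl[rotated])
    qed simp
    then show "b \<in> Q (Suc n)" using x(1) X'm unfolding Q_def by blast
  qed
  define G' where "G' n = J n \<inter> Q n" for n
  have Gm: "G' n \<subseteq> G' (Suc n)" for n using stab(1)[of n] Qm[of n] unfolding G'_def by blast
  have Gmono: "m \<le> n \<Longrightarrow> G' m \<subseteq> G' n" for m n by (rule lift_Suc_mono_le[of G']) (rule Gm)
  define R where "R = (\<Union>n. Q n)"
  define G where "G = (\<Union>n. G' n)"
  have Gi: "indep f G"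
    unfolding G_def
  proof (rule M.indep_chain_Union[OF finf])
    fix A B assume "A \<in> range G'" "B \<in> range G'"
    then show "A \<subseteq> B \<or> B \<subseteq> A" using Gmono by (metis imageE nle_le)
  next
    fix A assume "A \<in> range G'"
    then show "indep f A" using M.indep_subset[OF Ji(1)] unfolding G'_def by blast
  qed
  have RG: "R \<subseteq> f G"
  proof -
    have "Q n \<subseteq> f (G' n)" for n unfolding G'_def by (rule closed_f[OF Ji(1) Qcl Qf])
    moreover have "f (G' n) \<subseteq> f G" for n unfolding G_def by (rule M.mono) blast
    ultimately show ?thesis unfolding R_def by blast
  qed
  have XR: "X \<subseteq> R" using XQ X'X unfolding R_def by blast
  have "indep (cl_contract g (- f G)) G"
    unfolding indep_def cl_contract_def
  proof (intro ballI notI)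
    fix a assume a: "a \<in> G" "a \<in> g (G - {a} \<union> - f G)"
    then obtain F where F: "F \<subseteq> G - {a} \<union> - f G" "finite F" "a \<in> g F" using finitaryD[OF fing] by blast
    \<comment> \<open>Every late \<open>J m - {a}\<close> spans each \<open>b\<close> of
      \<open>F\<close>: if \<open>b\<close> is in \<open>G\<close>, then it belongs to
      \<open>J m\<close>; otherwise \<open>b\<close> is outside \<open>R\<close>, hence eventually
      spanned, and by \<open>closed_g\<close> even from outside \<open>Q m\<close>, which contains
      \<open>a\<close>.\<close>
    have "\<exists>n. \<forall>m\<ge>n. F \<subseteq> g (J m - {a})" using F(2,1)
    proof induction
      case (insert b F)
      then obtain n where n: "\<forall>m\<ge>n. F \<subseteq> g (J m - {a})" by blast
      obtain k where k: "a \<in> G' k" using a(1) unfolding G_def by blast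
      have "\<exists>l. \<forall>m\<ge>l. b \<in> g (J m - {a})"
      proof (cases "b \<in> G")
        case True
        then obtain l where "b \<in> G' l" unfolding G_def by blast
        then have "b \<in> J m" if "m \<ge> l" for m using Gmono[OF that] unfolding G'_def by blast
        moreover have "b \<noteq> a" using insert.prems True M.ext[of G] by blast
        ultimately have "b \<in> g (J m - {a})" if "m \<ge> l" for m
          using N.ext[of "J m - {a}"] that by blast
        then show ?thesis by blast
      next
        case False
        then have b: "b \<notin> R" using insert.prems RG by blast
        then obtain l where l: "b \<in> g (J l)" using XR unfolding X_def T_def by blast
        have "b \<in> g (J m - {a})" if "m \<ge> max k l" for m
        proof -
          have "b \<in> g (J m)" "b \<notin> Q m" using l gmono[of l m] that b unfolding R_def by auto
          then have "b \<in> g (J m - Q m)" using closed_g[OF Ji(2) Qcl] by blast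
          moreover have "a \<in> Q m" using k Gmono[of k m] that unfolding G'_def by auto
          ultimately show ?thesis using N.mono[of "J m - Q m" "J m - {a}"] by blast
        qed
        then show ?thesis by blast
      qed
      then obtain l where "\<forall>m\<ge>l. b \<in> g (J m - {a})" by blast
      then show ?case using n by (intro exI[of _ "max n l"]) auto
    qed simp
    then obtain n where n: "\<And>m. m \<ge> n \<Longrightarrow> F \<subseteq> g (J m - {a})" by blast
    obtain k where k: "a \<in> G' k" using a(1) unfolding G_def by blast
    have "a \<in> J (max n k)" using k Gmono[of k "max n k"] unfolding G'_def by auto
    moreover have "a \<in> g (J (max n k) - {a})" using N.cl_mem[OF F(3) n[of "max n k"]] by simp
    ultimately show False using Ji(2) unfolding indep_def by blast
  qed
  then have "wave f g G" using Gi by (simp add: wave_def)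
  \<comment> \<open>With \<open>G\<close> empty, \<open>R\<close> and so all never spanned elements
    are loops of \<open>f\<close>. By the loop condition of \<open>nice\<close> everything is then
    spanned eventually, including \<open>e\<close>.\<close>
  then have "G = {}" using n unfolding nice_def by blast
  then have "- f {} \<subseteq> T" using RG XR unfolding X_def by blast
  then have "g (- f {}) \<subseteq> g T" by (rule N.mono)
  then have "T = UNIV" using n Tcl unfolding nice_def by blast
  then show False using eX unfolding X_def by blast
qed

end

text \<open>A feasible set leaves a nice pair behind, so \<open>nice_spannable\<close> applies again
  after contraction, once for each non-loop of \<open>g\<close>. Only spanning is asked of
  \<open>K\<close> in \<open>g\<close>; a base inside it is chosen later.\<close>

lemma (in matroid_pair) nice_solution_finitary:
  assumes n: "nice f g" and finf: "finitary f" and fing: "finitary g" and count: "countable (- g {})"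
  shows "\<exists>K. indep f K \<and> g K = UNIV"
proof (cases "- g {} = {}")
  case True
  then show ?thesis by (intro exI[of _ "{}"]) auto
next
  case False
  define e where "e = from_nat_into (- g {})"
  have re: "range e = - g {}" unfolding e_def using False count by (rule range_from_nat_into)
  have ex: "\<exists>J'. feasible f g J' \<and> (J \<subseteq> J' \<and> e n \<in> g J')" if J: "feasible f g J" for J n
  proof -
    interpret C: matroid_pair "cl_contract f J" "cl_contract g J" by (rule matroid_pair_contr)
    have "- cl_contract g J {} \<subseteq> - g {}" unfolding cl_contract_def using N.mono[of "{}" "{} \<union> J"] by blast
    then have "countable (- cl_contract g J {})" by (rule countable_subset) (rule count)
    then obtain K where K: "feasible (cl_contract f J) (cl_contract g J) K" "e n \<in> cl_contract g J K"
      using C.nice_spannable[OF _ M.finitary_contract[OF finf]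
          N.finitary_contract[OF fing]] J unfolding feasible_def by blast
    then show ?thesis using feasible_Un[OF J K(1)]
      by (intro exI[of _ "J \<union> K"]) (auto simp: cl_contract_def Un_commute)
  qed
  have "feasible f g {}" using n by (simp add: feasible_def)
  then obtain I where I: "\<And>n. feasible f g (I n)" "\<And>n. I n \<subseteq> I (Suc n) \<and> e n \<in> g (I (Suc n))"
    using dependent_nat_choice[of "\<lambda>_. feasible f g" "\<lambda>n J J'. J \<subseteq> J' \<and> e n \<in> g J'"] ex by blast
  have Imono: "m \<le> n \<Longrightarrow> I m \<subseteq> I n" for m n by (rule lift_Suc_mono_le[of I]) (use I in blast)
  let ?K = "\<Union>n. I n"
  have "indep f ?K"
  proof (rule M.indep_chain_Union[OF finf])
    fix A B assume "A \<in> range I" "B \<in> range I"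
    then show "A \<subseteq> B \<or> B \<subseteq> A" using Imono by (metis imageE nle_le)
  next
    fix A assume "A \<in> range I"
    then show "indep f A" using I(1) unfolding feasible_def by blast
  qed
  moreover have "g ?K = UNIV"
  proof -
    have "e n \<in> g ?K" for n using I(2)[of n] N.mono[of "I (Suc n)" ?K] by blast
    then have "range e \<subseteq> g ?K" by blast
    then have "- g {} \<subseteq> g ?K" unfolding re .
    then show ?thesis using N.mono[of "{}" ?K] by blast
  qed
  ultimately show ?thesis by blast
qed

section \<open>The intersection property\<close>

lemma indep_delete: "indep (cl_delete f W) A \<longleftrightarrow> A \<inter> W = {} \<and> indep f A"
proof -
  have "A - {a} - W = A - {a}" if "A \<inter> W = {}" for a using that by blast
  then show ?thesis unfolding indep_def cl_delete_def by (cases "A \<inter> W = {}") auto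
qed

lemma (in imatroid) imatroid_delete: "imatroid (cl_delete cl W)"
proof unfold_locales
  fix X Y :: "'a set" and x y :: 'a
  show "X \<subseteq> cl_delete cl W X" unfolding cl_delete_def using ext[of "X - W"] by blast
  show "X \<subseteq> Y \<Longrightarrow> cl_delete cl W X \<subseteq> cl_delete cl W Y"
    unfolding cl_delete_def using mono[of "X - W" "Y - W"] by blast
  have "cl (cl (X - W) \<union> W - W) \<subseteq> cl (X - W)" by (rule cl_least) blast
  then show "cl_delete cl W (cl_delete cl W X) \<subseteq> cl_delete cl W X" unfolding cl_delete_def by blast
  assume y: "y \<in> cl_delete cl W (insert x X)" "y \<notin> cl_delete cl W X"
  then have "x \<notin> W" unfolding cl_delete_def by (auto simp: insert_Diff_if)
  moreover have "y \<notin> W" using y(2) unfolding cl_delete_def by blast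
  ultimately show "x \<in> cl_delete cl W (insert y X)"
    using exch[of y x "X - W"] y unfolding cl_delete_def by (auto simp: insert_Diff_if)
next
  fix I X assume I: "indep (cl_delete cl W) I" "I \<subseteq> X"
  then obtain B where "I \<subseteq> B" "B \<subseteq> X - W" "indep cl B" "X - W \<subseteq> cl B"
    using basis[of I "X - W"] unfolding indep_delete by blast
  moreover then have "B - W = B" by blast
  ultimately show "\<exists>B. I \<subseteq> B \<and> B \<subseteq> X \<and> indep (cl_delete cl W) B \<and> X \<subseteq> cl_delete cl W B"
    unfolding indep_delete by (intro exI[of _ B]) (auto simp: cl_delete_def)
qed

lemma finitary_delete:
  assumes "finitary f"
  shows "finitary (cl_delete f W)"
  unfolding finitary_def
proof (intro allI ballI)
  fix X x assume x: "x \<in> cl_delete f W X"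
  show "\<exists>F\<subseteq>X. finite F \<and> x \<in> cl_delete f W F"
  proof (cases "x \<in> W")
    case True
    then show ?thesis by (intro exI[of _ "{}"]) (simp add: cl_delete_def)
  next
    case False
    then obtain F where F: "F \<subseteq> X - W" "finite F" "x \<in> f F"
      using finitaryD[OF assms, of x "X - W"] x unfolding cl_delete_def by blast
    moreover have "F - W = F" using F(1) by blast
    ultimately show ?thesis by (intro exI[of _ F]) (auto simp: cl_delete_def)
  qed
qed

definition has_intersection :: "('a set \<Rightarrow> 'a set) \<Rightarrow> ('a set \<Rightarrow> 'a set) \<Rightarrow> bool" where
  "has_intersection f g \<longleftrightarrow> (\<exists>I R. indep f I \<and> indep g I \<and> R \<subseteq> f (I \<inter> R) \<and> - R \<subseteq> g (I - R))"

lemma has_intersection_sym: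
  assumes "has_intersection f g"
  shows "has_intersection g f"
proof -
  obtain I R where "indep f I" "indep g I" "R \<subseteq> f (I \<inter> R)" "- R \<subseteq> g (I - R)"
    using assms unfolding has_intersection_def by blast
  then show ?thesis unfolding has_intersection_def
    by (intro exI[of _ I] exI[of _ "- R"]) (simp add: Diff_eq)
qed

context matroid_pair
begin

text \<open>Let \<open>W\<close> be the closure of a maximal wave \<open>A\<close>. Contracting
  \<open>W\<close> in \<open>f\<close> and deleting it in \<open>g\<close> gives a nice pair. A
  solution of it, thinned to a base in \<open>g\<close>, is glued to \<open>A\<close>: the wave
  spans \<open>W\<close> in \<open>f\<close>, the solution spans the rest in \<open>g\<close>. The
  hypothesis \<open>sol\<close> is supplied separately for finitary and cofinitary
  \<open>g\<close>.\<close>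

lemma has_intersection_if_nice_solution:
  assumes fin: "finitary f"
    and sol: "\<And>W. nice (cl_contract f W) (cl_delete g W) \<Longrightarrow> \<exists>K. indep (cl_contract f W) K \<and> cl_delete g W K = UNIV"
  shows "has_intersection f g"
proof -
  obtain A where A: "wave f g A" "\<And>B. wave f g B \<Longrightarrow> A \<subseteq> B \<Longrightarrow> B = A"
    using maximal_wave[OF fin] by blast
  define W where "W = f A"
  have AW: "A \<subseteq> W" unfolding W_def by (rule M.ext)
  have fW: "f W = W" unfolding W_def using M.idem M.ext by blast
  have fA: "indep f A" and gA: "indep (cl_contract g (- W)) A" using A(1) unfolding wave_def W_def by auto
  have con: "cl_contract f W = cl_contract f A"
  proof (rule HOL.ext)
    fix X show "cl_contract f W X = cl_contract f A X"
      unfolding cl_contract_def using M.cl_Un_cong[of W A X] fW W_def by simp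
  qed
  have "nice (cl_contract f W) (cl_delete g W)"
    unfolding nice_def
  proof (intro conjI allI impI)
    fix B assume "wave (cl_contract f W) (cl_delete g W) B"
    then have B: "indep (cl_contract f A) B" "indep (cl_contract (cl_delete g W) (- cl_contract f A B)) B"
      unfolding wave_def con by auto
    define Y where "Y = - cl_contract f A B"
    have BW: "B \<inter> W = {}" using M.indep_contr_disj[OF B(1)] unfolding W_def by blast
    have YW: "Y \<inter> W = {}" unfolding Y_def cl_contract_def W_def using M.mono[of A "B \<union> A"] by blast
    \<comment> \<open>Neither \<open>B\<close> nor \<open>Y\<close> meets \<open>W\<close>, so
      deleting \<open>W\<close> has no effect here and the second alternative of
      \<open>wave_extend\<close> applies.\<close>
    have "indep (cl_contract g Y) B"
      unfolding indep_def cl_contract_def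
    proof
      fix b assume b: "b \<in> B"
      have "B - {b} \<union> Y - W = B - {b} \<union> Y" using BW YW by blast
      then show "b \<notin> g (B - {b} \<union> Y)"
        using B(2) b unfolding indep_def cl_contract_def[of "cl_delete g W"] cl_delete_def Y_def[symmetric] by auto
    qed
    then have "wave (cl_contract f A) g B" using B(1) unfolding wave_def Y_def by blast
    then have "A \<union> B = A" using A(2)[of "A \<union> B"] wave_extend[OF A(1), of B] by blast
    then show "B = {}" using BW AW by blast
  next
    have "cl_contract f W {} = W" using fW by (simp add: cl_contract_def)
    then show "cl_delete g W (- cl_contract f W {}) = UNIV"
      unfolding cl_delete_def using N.ext[of "- W - W"] by auto
  qed
  then obtain K where K: "indep (cl_contract f A) K" "cl_delete g W K = UNIV" using sol con by metis
  have KW: "K \<inter> W = {}" using M.indep_contr_disj[OF K(1)] unfolding W_def by blast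
  obtain K' where K': "K' \<subseteq> K" "indep g K'" "K \<subseteq> g K'" using N.basis[of "{}" K] by auto
  have "- W \<subseteq> g (K - W)" using K(2) unfolding cl_delete_def by blast
  also have "\<dots> \<subseteq> g K'" using K'(3) by (intro N.cl_least) blast
  finally have span: "- W \<subseteq> g K'" .
  have "indep (cl_contract f A) K'" using imatroid.axioms(1)[OF M.imatroid_contract] K(1) K'(1)
    by (rule closure_op.indep_subset)
  then have "indep f (A \<union> K')" by (rule M.indep_Un[OF fA])
  moreover have "indep g (A \<union> K')"
  proof -
    have "K' \<subseteq> g (- W)" using K'(1) KW N.ext[of "- W"] by blast
    then have "indep g (K' \<union> A)" by (intro N.indep_Un[OF K'(2)] N.indep_contr_mono[OF gA])
    then show ?thesis by (simp add: Un_commute)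
  qed
  moreover have "W \<subseteq> f ((A \<union> K') \<inter> W)" unfolding W_def[symmetric]
    using AW M.mono[of A "(A \<union> K') \<inter> W"] W_def by blast
  moreover have "- W \<subseteq> g (A \<union> K' - W)"
    using span K'(1) KW N.mono[of K' "A \<union> K' - W"] by blast
  ultimately show ?thesis unfolding has_intersection_def by blast
qed

lemma has_intersection_finitary:
  assumes "finitary f" "finitary g" "countable (- g {})"
  shows "has_intersection f g"
proof (rule has_intersection_if_nice_solution[OF assms(1)])
  fix W assume n: "nice (cl_contract f W) (cl_delete g W)"
  interpret C: matroid_pair "cl_contract f W" "cl_delete g W"
    by (intro matroid_pair.intro M.imatroid_contract N.imatroid_delete)
  have "- cl_delete g W {} \<subseteq> - g {}" unfolding cl_delete_def by auto
  then have "countable (- cl_delete g W {})" by (rule countable_subset) (rule assms(3))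
  then show "\<exists>K. indep (cl_contract f W) K \<and> cl_delete g W K = UNIV"
    by (rule C.nice_solution_finitary[OF n M.finitary_contract[OF assms(1)] finitary_delete[OF assms(2)]])
qed

text \<open>If \<open>f\<close> is finitary and \<open>g\<close> is cofinitary, then being independent in \<open>f\<close> and spanning in \<open>g\<close> are
  both decided by finite sets, so a compactness argument reduces the problem to finite minors.\<close>

lemma nice_finite_solution:
  assumes n: "nice f g" and F: "finite F"
  shows "\<exists>I. I \<subseteq> F \<and> indep f I \<and> g (I \<union> - F) = UNIV"
proof -
  define P where "P I \<longleftrightarrow> indep f I \<and> indep (cl_contract g (- F)) I" for I
  have sub: "I \<subseteq> F" if "P I" for I
    using that N.indep_contr_disj[of "- F" I] N.ext[of "- F"] unfolding P_def by blast
  have "P {}" by (simp add: P_def indep_def)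
  moreover have "\<forall>I. P I \<longrightarrow> card I < Suc (card F)" using sub F by (simp add: card_mono less_Suc_eq_le)
  \<comment> \<open>A largest common independent subset of \<open>F\<close> admits no augmentation,
    which would add one more element than it removes.\<close>
  ultimately obtain I where I: "P I" "\<And>J. P J \<Longrightarrow> card J \<le> card I"
    using ex_has_greatest_nat[of P "{}" card "Suc (card F)"] by blast
  have "g (I \<union> - F) = UNIV"
  proof (rule ccontr)
    assume "g (I \<union> - F) \<noteq> UNIV"
    then obtain I' where I': "indep f I'" "indep (cl_contract g (- F)) I'"
      "card (I' - I) = Suc (card (I - I'))"
      using nice_augment[OF n, of I "- F"] I(1) unfolding P_def by metis
    then have PI': "P I'" by (simp add: P_def)
    have fin: "finite I" "finite I'" using sub[OF I(1)] sub[OF PI'] F finite_subset by auto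
    have "card I' = card (I' \<inter> I) + card (I' - I)" "card I = card (I' \<inter> I) + card (I - I')"
      using card_Int_Diff[OF fin(2), of I] card_Int_Diff[OF fin(1), of I'] by (simp_all add: Int_commute)
    then show False using I(2)[OF PI'] I'(3) by simp
  qed
  then show ?thesis using I(1) sub unfolding P_def by blast
qed

text \<open>Compactness by Zorn's lemma: choose \<open>X\<close> maximal such that every finite
  \<open>F\<close> has a solution avoiding \<open>X\<close>. The complement of \<open>X\<close> then
  induces a solution on every finite set, and a failure of either required property would show on a
  finite set.\<close>

lemma nice_solution_cofinitary:
  assumes n: "nice f g" and finf: "finitary f" and fing: "finitary (cl_dual E g)" and out: "- E \<subseteq> g {}"
  shows "\<exists>K. indep f K \<and> g K = UNIV"
proof -
  define Sol where "Sol F I \<longleftrightarrow> I \<subseteq> F \<and> indep f I \<and> g (I \<union> - F) = UNIV" for F I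
  have restr: "Sol G (I \<inter> G)" if "Sol F I" "G \<subseteq> F" for F G I
  proof -
    have "g (I \<union> - F) \<subseteq> g (I \<inter> G \<union> - G)" using that(2) by (intro N.mono) blast
    then show ?thesis using that M.indep_subset[of I "I \<inter> G"] unfolding Sol_def by blast
  qed
  define C where "C = {X. \<forall>F. finite F \<longrightarrow> (\<exists>I. Sol F I \<and> I \<inter> X = {})}"
  have "\<exists>X\<in>C. \<forall>Y\<in>C. X \<subseteq> Y \<longrightarrow> Y = X"
  proof (rule subset_Zorn_nonempty)
    have "{} \<in> C" unfolding C_def Sol_def using nice_finite_solution[OF n] by auto
    then show "C \<noteq> {}" by blast
    fix D assume D: "D \<noteq> {}" "subset.chain C D"
    have "\<exists>I. Sol F I \<and> I \<inter> \<Union>D = {}" if F: "finite F" for F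
    proof -
      obtain X where X: "X \<in> D" "F \<inter> \<Union>D \<subseteq> X"
        using finite_subset_Union_chain[of "F \<inter> \<Union>D" D C] F D by blast
      then have "X \<in> C" using D(2) unfolding subset.chain_def by blast
      then obtain I where I: "Sol F I" "I \<inter> X = {}" using F unfolding C_def by blast
      then have "I \<subseteq> F" unfolding Sol_def by (elim conjE)
      then have "I \<inter> \<Union>D = {}" using X(2) I(2) by blast
      then show ?thesis using I(1) by blast
    qed
    then show "\<Union>D \<in> C" unfolding C_def by blast
  qed
  then obtain X where X: "X \<in> C" "\<And>Y. Y \<in> C \<Longrightarrow> X \<subseteq> Y \<Longrightarrow> Y = X" by blast
  \<comment> \<open>By maximality each \<open>k\<close> of \<open>F - X\<close> is forced by some
    finite \<open>G k\<close>: the solutions for \<open>G k\<close> that avoid \<open>X\<close>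
    contain \<open>k\<close>. A solution for the union of \<open>F\<close> and these sets restricts
    to \<open>F - X\<close>.\<close>
  have sol: "Sol F (F - X)" if F: "finite F" for F
  proof -
    have "\<forall>k\<in>F - X. \<exists>G. finite G \<and> (\<forall>I. Sol G I \<and> I \<inter> X = {} \<longrightarrow> k \<in> I)"
    proof
      fix k assume k: "k \<in> F - X"
      then have "insert k X \<notin> C" using X(2)[of "insert k X"] k by blast
      then obtain G where "finite G" "\<not> (\<exists>I. Sol G I \<and> I \<inter> insert k X = {})" unfolding C_def by blast
      then show "\<exists>G. finite G \<and> (\<forall>I. Sol G I \<and> I \<inter> X = {} \<longrightarrow> k \<in> I)" by blast
    qed
    from bchoice[OF this] obtain G where
      G: "\<forall>k\<in>F - X. finite (G k) \<and> (\<forall>I. Sol (G k) I \<and> I \<inter> X = {} \<longrightarrow> k \<in> I)" ..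
    define H where "H = F \<union> (\<Union>k\<in>F - X. G k)"
    have "finite H" unfolding H_def using F G by blast
    then obtain I where I: "Sol H I" "I \<inter> X = {}" using X(1) unfolding C_def by blast
    have "F - X \<subseteq> I"
    proof
      fix k assume k: "k \<in> F - X"
      have "Sol (G k) (I \<inter> G k)" using restr[OF I(1), of "G k"] k unfolding H_def by blast
      moreover have "I \<inter> G k \<inter> X = {}" using I(2) by blast
      ultimately have "k \<in> I \<inter> G k" using G k by blast
      then show "k \<in> I" by blast
    qed
    then have "I \<inter> F = F - X" using I(2) by blast
    moreover have "F \<subseteq> H" unfolding H_def by blast
    ultimately show ?thesis using restr[OF I(1), of F] by simp
  qed
  have "indep f (- X)"
    unfolding indep_def
  proof (intro ballI notI)
    fix a assume a: "a \<in> - X" "a \<in> f (- X - {a})"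
    then obtain F where F: "F \<subseteq> - X - {a}" "finite F" "a \<in> f F" using finitaryD[OF finf] by blast
    have "insert a F - X = insert a F" using F(1) a(1) by blast
    then have "indep f (insert a F)" using sol[of "insert a F"] F(2) unfolding Sol_def by simp
    moreover have "F \<subseteq> insert a F - {a}" using F(1) by blast
    ultimately show False using F(3) M.mono[of F "insert a F - {a}"] unfolding indep_def by blast
  qed
  moreover have "g (- X) = UNIV"
  proof -
    have cl_E: "g (E \<inter> Z) = g Z" for Z
    proof (rule N.cl_eqI)
      show "E \<inter> Z \<subseteq> g Z" using N.ext by blast
      show "Z \<subseteq> g (E \<inter> Z)" using N.ext[of "E \<inter> Z"] N.mono[of "{}" "E \<inter> Z"] out by blast
    qed
    \<comment> \<open>If \<open>- X\<close> does not span \<open>a\<close>, the rest of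
      \<open>X\<close> spans \<open>a\<close> in the dual, and so does a finite part
      \<open>F\<close>. The solution induced on \<open>insert a F\<close> is empty, so the
      complement of that set spans \<open>a\<close>, a contradiction.\<close>
    have "X \<inter> E \<subseteq> g (- X)"
    proof (intro subsetI, rule ccontr)
      fix a assume a: "a \<in> X \<inter> E" "a \<notin> g (- X)"
      have "g (E - (X \<inter> E - {a}) - {a}) \<subseteq> g (- X)"
        unfolding cl_E[of "- X", symmetric] using a(1) by (intro N.mono) blast
      then have "a \<in> cl_dual E g (X \<inter> E - {a})" using a(2) unfolding cl_dual_def by blast
      from finitaryD[OF fing this]
      obtain F where F: "F \<subseteq> X \<inter> E - {a}" "finite F" "a \<in> cl_dual E g F" by (elim exE conjE)
      have "a \<notin> F" using F(1) by blast
      then have na: "a \<notin> g (E - F - {a})" using F(3) a(1) unfolding cl_dual_def by blast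
      have "insert a F - X = {}" using F(1) a(1) by blast
      moreover have "g (insert a F - X \<union> - insert a F) = UNIV"
        using sol[of "insert a F"] F(2) unfolding Sol_def by blast
      ultimately have "g (- insert a F) = UNIV" by (simp only: Un_empty_left)
      moreover have "E - F - {a} = E \<inter> - insert a F" by blast
      ultimately show False using na cl_E[of "- insert a F"] by simp
    qed
    then have "X \<subseteq> g (- X)" using out N.mono[of "{}" "- X"] by blast
    then show ?thesis using N.ext[of "- X"] by blast
  qed
  ultimately show ?thesis by blast
qed

text \<open>Deleting \<open>W\<close> in \<open>g\<close> means contracting it in the dual, and
  contraction preserves finitariness.\<close>

lemma finitary_dual_delete:
  assumes "finitary (cl_dual E g)"
  shows "finitary (cl_dual (E - W) (cl_delete g W))"
  unfolding finitary_def
proof (intro allI ballI)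
  have eq: "cl_dual (E - W) (cl_delete g W) X = X \<union> - (E - W) \<union> cl_dual E g (X \<union> W)" for X
  proof -
    have "E - W - X - {e} - W = E - (X \<union> W) - {e}" for e by blast
    then show ?thesis unfolding cl_dual_def cl_delete_def by auto
  qed
  fix X x assume x: "x \<in> cl_dual (E - W) (cl_delete g W) X"
  then consider "x \<in> X" | "x \<notin> E - W" | "x \<in> cl_dual E g (X \<union> W)" unfolding eq by blast
  then show "\<exists>F\<subseteq>X. finite F \<and> x \<in> cl_dual (E - W) (cl_delete g W) F"
  proof cases
    case 1 then show ?thesis unfolding eq by (intro exI[of _ "{x}"]) auto
  next
    case 2 then show ?thesis unfolding eq by (intro exI[of _ "{}"]) auto
  next
    case 3
    then obtain F where F: "F \<subseteq> X \<union> W" "finite F" "x \<in> cl_dual E g F" using finitaryD[OF assms] by blast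
    have "g (E - (F \<inter> X \<union> W) - {x}) \<subseteq> g (E - F - {x})" using F(1) by (intro N.mono) blast
    then have "x \<in> cl_dual E g (F \<inter> X \<union> W)" using F(1,3) unfolding cl_dual_def by blast
    then show ?thesis unfolding eq using F(2) by (intro exI[of _ "F \<inter> X"]) auto
  qed
qed

lemma has_intersection_mixed:
  assumes "finitary f" "finitary (cl_dual E g)" "- E \<subseteq> g {}"
  shows "has_intersection f g"
proof (rule has_intersection_if_nice_solution[OF assms(1)])
  fix W assume n: "nice (cl_contract f W) (cl_delete g W)"
  interpret C: matroid_pair "cl_contract f W" "cl_delete g W"
    by (intro matroid_pair.intro M.imatroid_contract N.imatroid_delete)
  have "- (E - W) \<subseteq> cl_delete g W {}" using assms(3) unfolding cl_delete_def by auto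
  then show "\<exists>K. indep (cl_contract f W) K \<and> cl_delete g W K = UNIV"
    by (rule C.nice_solution_cofinitary[OF n M.finitary_contract[OF assms(1)] finitary_dual_delete[OF assms(2)]])
qed

end

section \<open>Finitarization and finite deficiency\<close>

lemma (in closure_op) imatroid_if_finitary:
  assumes "finitary cl"
  shows "imatroid cl"
proof unfold_locales
  fix I X :: "'a set" assume I: "indep cl I" "I \<subseteq> X"
  define S where "S = {B. I \<subseteq> B \<and> B \<subseteq> X \<and> indep cl B}"
  have "\<exists>B\<in>S. \<forall>A\<in>S. B \<subseteq> A \<longrightarrow> A = B"
  proof (rule subset_Zorn_nonempty)
    show "S \<noteq> {}" using I unfolding S_def by blast
    fix C assume C: "C \<noteq> {}" "subset.chain S C"
    have CS: "C \<subseteq> S" using C(2) unfolding subset.chain_def by blast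
    have "indep cl (\<Union>C)"
    proof (rule indep_chain_Union[OF assms])
      show "A \<subseteq> B \<or> B \<subseteq> A" if "A \<in> C" "B \<in> C" for A B
        using C(2) that unfolding subset.chain_def by blast
      show "indep cl A" if "A \<in> C" for A using CS that unfolding S_def by blast
    qed
    then show "\<Union>C \<in> S" using C(1) CS unfolding S_def by blast
  qed
  then obtain B where BS: "B \<in> S" and max: "\<forall>A\<in>S. B \<subseteq> A \<longrightarrow> A = B" ..
  have B: "I \<subseteq> B" "B \<subseteq> X" "indep cl B" using BS unfolding S_def by blast+
  have "x \<in> cl B" if x: "x \<in> X" for x
  proof (rule ccontr)
    assume n: "x \<notin> cl B"
    then have "insert x B \<in> S" using indep_insert[OF B(3) n] B x unfolding S_def by blast
    then have "insert x B = B" using max by blast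
    then show False using n ext[of B] by blast
  qed
  then show "\<exists>B. I \<subseteq> B \<and> B \<subseteq> X \<and> indep cl B \<and> X \<subseteq> cl B" using B by blast
qed

lemma finitary_fin: "finitary (cl_fin f)"
  unfolding finitary_def cl_fin_def by blast

lemma (in imatroid) fin_le: "cl_fin cl X \<subseteq> cl X"
  unfolding cl_fin_def using mono by blast

lemma (in imatroid) imatroid_fin: "imatroid (cl_fin cl)"
proof -
  have "closure_op (cl_fin cl)"
  proof
    fix X Y :: "'a set" and x y :: 'a
    show "X \<subseteq> cl_fin cl X"
    proof
      fix x assume "x \<in> X"
      then show "x \<in> cl_fin cl X" unfolding cl_fin_def using ext[of "{x}"] by (intro CollectI exI[of _ "{x}"]) simp
    qed
    show "X \<subseteq> Y \<Longrightarrow> cl_fin cl X \<subseteq> cl_fin cl Y" unfolding cl_fin_def by blast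
    show "cl_fin cl (cl_fin cl X) \<subseteq> cl_fin cl X"
    proof
      fix x assume "x \<in> cl_fin cl (cl_fin cl X)"
      then obtain F where F: "F \<subseteq> cl_fin cl X" "finite F" "x \<in> cl F" unfolding cl_fin_def[of cl "cl_fin cl X"] by blast
      have "\<exists>G. G \<subseteq> X \<and> finite G \<and> F \<subseteq> cl G" using F(2,1)
      proof induction
        case (insert a F)
        then obtain G where G: "G \<subseteq> X" "finite G" "F \<subseteq> cl G" by blast
        obtain H where H: "H \<subseteq> X" "finite H" "a \<in> cl H" using insert.prems unfolding cl_fin_def by blast
        have "insert a F \<subseteq> cl (G \<union> H)" using G H mono[of G "G \<union> H"] mono[of H "G \<union> H"] by blast
        then show ?case using G H by (intro exI[of _ "G \<union> H"]) simp
      next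
        case empty
        then show ?case by (intro exI[of _ "{}"]) simp
      qed
      then show "x \<in> cl_fin cl X" using F(3) cl_mem unfolding cl_fin_def by blast
    qed
    assume y: "y \<in> cl_fin cl (insert x X)" "y \<notin> cl_fin cl X"
    then obtain F where F: "F \<subseteq> insert x X" "finite F" "y \<in> cl F" unfolding cl_fin_def by blast
    have "F - {x} \<subseteq> X" "finite (F - {x})" using F by auto
    then have n: "y \<notin> cl (F - {x})" using y(2) unfolding cl_fin_def by blast
    have "y \<in> cl (insert x (F - {x}))" using F(3) mono[of F "insert x (F - {x})"] by blast
    then have "x \<in> cl (insert y (F - {x}))" using exch n by blast
    then show "x \<in> cl_fin cl (insert y X)"
      unfolding cl_fin_def using F by (intro CollectI exI[of _ "insert y (F - {x})"]) auto
  qed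
  then show ?thesis by (rule closure_op.imatroid_if_finitary) (rule finitary_fin)
qed

section \<open>Steinitz exchange and finite deficiency\<close>

context imatroid
begin

text \<open>Add the elements of \<open>Q\<close> to \<open>A\<close> one at a time; the one at which
  \<open>a\<close> becomes spanned can be exchanged for \<open>a\<close>.\<close>

lemma steinitz_step:
  assumes "finite Q" "a \<in> cl (A \<union> Q)" "a \<notin> cl A"
  shows "\<exists>q\<in>Q. q \<in> cl (insert a (A \<union> (Q - {q})))"
  using assms
proof (induction Q)
  case (insert q Q)
  show ?case
  proof (cases "a \<in> cl (A \<union> Q)")
    case True
    then obtain p where p: "p \<in> Q" "p \<in> cl (insert a (A \<union> (Q - {p})))" using insert by blast
    have "insert a (A \<union> (Q - {p})) \<subseteq> insert a (A \<union> (insert q Q - {p}))" by blast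
    then show ?thesis using p mono by blast
  next
    case False
    have "a \<in> cl (insert q (A \<union> Q))" using insert.prems(1) by simp
    then have "q \<in> cl (insert a (A \<union> Q))" using exch False by blast
    moreover have "insert q Q - {q} = Q" using insert.hyps(2) by blast
    ultimately show ?thesis by auto
  qed
qed simp

lemma steinitz:
  assumes "finite A" "indep cl A" "A \<subseteq> cl Q" "finite Q"
  shows "\<exists>Q'. Q' \<subseteq> Q \<and> card Q' + card A = card Q \<and> Q \<subseteq> cl (A \<union> Q')"
  using assms
proof (induction A)
  case empty
  then show ?case using ext by (intro exI[of _ Q]) simp
next
  case (insert a A)
  have A: "indep cl A" using indep_subset[OF insert.prems(1)] by blast
  have na: "a \<notin> cl A" using insert.prems(1) insert.hyps(2) unfolding indep_def by simp
  obtain Q' where Q': "Q' \<subseteq> Q" "card Q' + card A = card Q" "Q \<subseteq> cl (A \<union> Q')"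
    using insert.IH[OF A] insert.prems by blast
  have fin: "finite Q'" using Q'(1) insert.prems(3) finite_subset by blast
  have "a \<in> cl (A \<union> Q')" using cl_mem[OF _ Q'(3)] insert.prems(2) by blast
  then obtain q where q: "q \<in> Q'" "q \<in> cl (insert a (A \<union> (Q' - {q})))"
    using steinitz_step[OF fin _ na] by blast
  have "A \<union> Q' \<subseteq> cl (insert a (A \<union> (Q' - {q})))"
    using q ext[of "insert a (A \<union> (Q' - {q}))"] by blast
  then have "Q \<subseteq> cl (insert a (A \<union> (Q' - {q})))" using Q'(3) cl_least by blast
  moreover have "card (Q' - {q}) + card (insert a A) = card Q"
    using q(1) fin insert.hyps Q'(2) card_Suc_Diff1[OF fin q(1)] by simp
  ultimately show ?case using Q'(1) by (intro exI[of _ "Q' - {q}"]) auto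
qed

text \<open>\<open>P\<close> makes up for what \<open>I \<inter> R\<close> lacks to span
  \<open>R\<close>. Contract the part of \<open>R\<close> common to \<open>I\<close> and
  \<open>I'\<close>: the removed elements and \<open>P\<close> span \<open>R\<close>, and by
  \<open>steinitz\<close> the independent new elements replace equally many of them.\<close>

lemma finite_defect_exchange:
  assumes I': "indep cl I'" and fin: "finite (I - I')" "finite (I' - I)" "finite P"
    and sp: "R \<subseteq> cl (I \<inter> R \<union> P)"
  shows "\<exists>Q. finite Q \<and> R \<subseteq> cl (I' \<inter> R \<union> Q) \<and>
    card Q + card ((I' - I) \<inter> R) \<le> card ((I - I') \<inter> R) + card P"
proof -
  define K where "K = I \<inter> I' \<inter> R"
  define A where "A = (I' - I) \<inter> R"
  define S where "S = (I - I') \<inter> R \<union> P"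
  interpret C: imatroid "cl_contract cl K" by (rule imatroid_contract)
  have finA: "finite A" "finite S" using fin by (auto simp: A_def S_def)
  have "indep (cl_contract cl (I' - A \<union> {})) A"
    by (rule indep_contr_rest) (use I' in \<open>auto simp: A_def\<close>)
  then have Ai: "indep (cl_contract cl K) A"
    by (rule indep_contr_mono) (use ext[of "I' - A \<union> {}"] in \<open>auto simp: A_def K_def\<close>)
  have "I \<inter> R \<union> P = S \<union> K" unfolding S_def K_def by blast
  then have sp': "R \<subseteq> cl_contract cl K S" using sp unfolding cl_contract_def by simp
  then have "A \<subseteq> cl_contract cl K S" unfolding A_def by blast
  then obtain Q where Q: "Q \<subseteq> S" "card Q + card A = card S" "S \<subseteq> cl_contract cl K (A \<union> Q)"
    using C.steinitz[OF finA(1) Ai _ finA(2)] by blast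
  have "R \<subseteq> cl_contract cl K (A \<union> Q)" using sp' C.cl_least[OF Q(3)] by blast
  moreover have "A \<union> Q \<union> K = I' \<inter> R \<union> Q" unfolding A_def K_def by blast
  ultimately have "R \<subseteq> cl (I' \<inter> R \<union> Q)" unfolding cl_contract_def by simp
  moreover have "card S \<le> card ((I - I') \<inter> R) + card P" unfolding S_def by (rule card_Un_le)
  moreover have "finite Q" using Q(1) finA(2) finite_subset by blast
  ultimately show ?thesis using Q(2) unfolding A_def by (intro exI[of _ Q]) simp
qed

end

text \<open>A finite deficiency is removed by finitely many augmentations, since each of them lowers
  the total deficiency by one.\<close>

lemma (in matroid_pair) has_intersection_finite_defect:
  assumes "indep f I" "indep g I" "finite P" "finite P'"
    and "R \<subseteq> f (I \<inter> R \<union> P)" "- R \<subseteq> g (I \<inter> - R \<union> P')"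
  shows "has_intersection f g"
  using assms
proof (induction "card P + card P'" arbitrary: I P P' rule: less_induct)
  case less
  show ?case
  proof (rule augment_or_optimal[OF less.prems(1,2)])
    fix x z I' assume I': "indep f I'" "indep g I'" "finite (I - I')" "finite (I' - I)"
      "card (I' - I) = Suc (card (I - I'))"
    obtain Q where Q: "finite Q" "R \<subseteq> f (I' \<inter> R \<union> Q)"
      "card Q + card ((I' - I) \<inter> R) \<le> card ((I - I') \<inter> R) + card P"
      using M.finite_defect_exchange[OF I'(1,3,4) less.prems(3,5)] by blast
    obtain Q' where Q': "finite Q'" "- R \<subseteq> g (I' \<inter> - R \<union> Q')"
      "card Q' + card ((I' - I) \<inter> - R) \<le> card ((I - I') \<inter> - R) + card P'"
      using N.finite_defect_exchange[OF I'(2,3,4) less.prems(4,6)] by blast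
    have "card (I' - I) = card ((I' - I) \<inter> R) + card ((I' - I) \<inter> - R)"
      "card (I - I') = card ((I - I') \<inter> R) + card ((I - I') \<inter> - R)"
      using card_Int_Diff[OF I'(4), of R] card_Int_Diff[OF I'(3), of R] by (simp_all add: Diff_eq)
    then have "card Q + card Q' < card P + card P'" using Q(3) Q'(3) I'(5) by linarith
    then show ?thesis by (rule less.hyps[OF _ I'(1,2) Q(1) Q'(1) Q(2) Q'(2)])
  next
    fix S assume "S \<subseteq> f (I \<inter> S)" "- S \<subseteq> g (I - S)"
    then show ?thesis using less.prems(1,2) unfolding has_intersection_def by blast
  qed
qed

text \<open>Extend a solution for the finitarization to a base \<open>D\<close> of it and choose a
  base \<open>B\<close> of \<open>f\<close> inside \<open>D\<close>. Then \<open>D - B\<close> is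
  finite, so intersecting the solution with \<open>B\<close> makes it independent in
  \<open>f\<close> at the cost of a finite deficiency.\<close>

lemma (in matroid_pair) has_intersection_nearly_finitary:
  assumes nf: "\<And>B. indep f B \<Longrightarrow> f B = UNIV \<Longrightarrow>
      \<exists>F. finite F \<and> cl_fin f (B \<union> F) = UNIV"
    and ip: "has_intersection (cl_fin f) g"
  shows "has_intersection f g"
proof -
  interpret F: imatroid "cl_fin f" by (rule M.imatroid_fin)
  obtain I R where I: "indep (cl_fin f) I" "indep g I" "R \<subseteq> cl_fin f (I \<inter> R)" "- R \<subseteq> g (I - R)"
    using ip unfolding has_intersection_def by blast
  obtain D where D: "I \<subseteq> D" "indep (cl_fin f) D" "UNIV \<subseteq> cl_fin f D"
    using F.basis[OF I(1), of UNIV] by blast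
  obtain B where B: "B \<subseteq> D" "indep f B" "D \<subseteq> f B" using M.basis[of "{}" D] by auto
  have "f B = UNIV" using D(3) M.fin_le[of D] M.cl_least[OF B(3)] by blast
  then obtain S where S: "finite S" "cl_fin f (B \<union> S) = UNIV" using nf B(2) by blast
  interpret C: imatroid "cl_contract (cl_fin f) B" by (rule F.imatroid_contract)
  have DB: "indep (cl_contract (cl_fin f) B) (D - B)"
  proof -
    have "indep (cl_contract (cl_fin f) (D - (D - B) \<union> {})) (D - B)"
      by (rule F.indep_contr_rest) (use D(2) in auto)
    moreover have "D - (D - B) \<union> {} = B" using B(1) by blast
    ultimately show ?thesis by simp
  qed
  \<comment> \<open>\<open>D - B\<close> is independent over \<open>B\<close> in the finitarization,
    where \<open>S\<close> spans everything over \<open>B\<close>; so its finite subsets are no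
    larger than \<open>S\<close>.\<close>
  have bound: "card A \<le> card S" if A: "A \<subseteq> D - B" "finite A" for A
  proof -
    have "A \<subseteq> cl_contract (cl_fin f) B S" using S(2) unfolding cl_contract_def by (simp add: Un_commute)
    then show ?thesis using C.steinitz[OF A(2) C.indep_subset[OF DB A(1)] _ S(1)] by force
  qed
  have finDB: "finite (D - B)"
  proof (rule ccontr)
    assume "infinite (D - B)"
    then obtain A where "A \<subseteq> D - B" "finite A" "card A = Suc (card S)"
      using infinite_arbitrarily_large by blast
    then show False using bound[of A] by simp
  qed
  show ?thesis
  proof (rule has_intersection_finite_defect[of "I \<inter> B" "I - B" "I - B" R])
    show "indep f (I \<inter> B)" by (rule M.indep_subset[OF B(2)]) blast
    show "indep g (I \<inter> B)" by (rule N.indep_subset[OF I(2)]) blast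
    show "finite (I - B)" using finDB D(1) by (auto intro: finite_subset[of _ "D - B"])
    then show "finite (I - B)" .
    have "f (I \<inter> R) \<subseteq> f (I \<inter> B \<inter> R \<union> (I - B))" by (rule M.mono) blast
    then show "R \<subseteq> f (I \<inter> B \<inter> R \<union> (I - B))" using I(3) M.fin_le by blast
    have "g (I - R) \<subseteq> g (I \<inter> B \<inter> - R \<union> (I - B))" by (rule N.mono) blast
    then show "- R \<subseteq> g (I \<inter> B \<inter> - R \<union> (I - B))" using I(4) by blast
  qed
qed

section \<open>Duality\<close>

lemma dual_dual:
  assumes "imatroid f" "- E \<subseteq> f {}"
  shows "cl_dual E (cl_dual E f) = f"
proof
  interpret imatroid f by fact
  fix X
  have out: "e \<in> f Y" if "e \<notin> E" for e Y using that assms(2) mono[of "{}" Y] by blast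
  have "e \<in> cl_dual E (cl_dual E f) X \<longleftrightarrow> e \<in> f X" for e
  proof (cases "e \<in> E \<and> e \<notin> X")
    case True
    have "E - (E - X - {e}) - {e} = E \<inter> X - {e}" by blast
    moreover have "E \<inter> X - {e} = E \<inter> X" using True by blast
    moreover have "f (E \<inter> X) = f X"
    proof (rule cl_eqI)
      show "E \<inter> X \<subseteq> f X" using ext by blast
      show "X \<subseteq> f (E \<inter> X)" using ext[of "E \<inter> X"] out by blast
    qed
    ultimately show ?thesis using True by (simp add: cl_dual_def)
  next
    case False
    then have "e \<in> f X" using out ext by blast
    moreover have "e \<in> cl_dual E (cl_dual E f) X" using False by (auto simp: cl_dual_def)
    ultimately show ?thesis by blast
  qed
  then show "cl_dual E (cl_dual E f) X = f X" by blast
qed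

locale loops_outside = imatroid +
  fixes E :: "'a set"
  assumes out: "- E \<subseteq> cl {}"
begin

lemma outE: "e \<notin> E \<Longrightarrow> e \<in> cl X"
  using out mono[of "{}" X] by blast

lemma indep_ground: "indep cl A \<Longrightarrow> A \<subseteq> E"
  using indep_not_loop outE by blast

lemma indep_dual_iff: "indep (cl_dual E cl) A \<longleftrightarrow> A \<subseteq> E \<and> cl (E - A) = UNIV"
proof
  assume A: "indep (cl_dual E cl) A"
  have a: "a \<in> E \<and> a \<in> cl (E - A)" if "a \<in> A" for a
  proof -
    have "a \<notin> cl_dual E cl (A - {a})" using A that by (simp add: indep_def)
    moreover have "E - (A - {a}) - {a} = E - A" using that by blast
    ultimately show ?thesis by (auto simp: cl_dual_def)
  qed
  have "e \<in> cl (E - A)" for e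
    using a[of e] outE[of e] ext[of "E - A"] by (cases "e \<in> A"; cases "e \<in> E") auto
  then show "A \<subseteq> E \<and> cl (E - A) = UNIV" using a by blast
next
  assume A: "A \<subseteq> E \<and> cl (E - A) = UNIV"
  show "indep (cl_dual E cl) A"
    unfolding indep_def
  proof
    fix a assume a: "a \<in> A"
    have "E - (A - {a}) - {a} = E - A" using a by blast
    then show "a \<notin> cl_dual E cl (A - {a})" using A a by (auto simp: cl_dual_def)
  qed
qed

lemma imatroid_dual: "imatroid (cl_dual E cl)"
proof unfold_locales
  fix X Y :: "'a set" and x y :: 'a
  show "X \<subseteq> cl_dual E cl X" by (auto simp: cl_dual_def)
  show "cl_dual E cl X \<subseteq> cl_dual E cl Y" if "X \<subseteq> Y"
  proof -
    have "cl (E - Y - {e}) \<subseteq> cl (E - X - {e})" for e using that by (intro mono) blast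
    then show ?thesis using that unfolding cl_dual_def by blast
  qed
  show "cl_dual E cl (cl_dual E cl X) \<subseteq> cl_dual E cl X"
  proof (intro subsetI, rule ccontr)
    fix e assume e: "e \<in> cl_dual E cl (cl_dual E cl X)" "e \<notin> cl_dual E cl X"
    define D where "D = cl_dual E cl X - X"
    define Z where "Z = E - cl_dual E cl X - {e}"
    have eE: "e \<in> E" "e \<notin> X" "e \<in> cl (E - X - {e})" using e(2) by (auto simp: cl_dual_def)
    have eZ: "e \<notin> cl Z" using e eE(1) unfolding Z_def cl_dual_def[of E cl "cl_dual E cl X"] by blast
    have cover: "E - X - {e} \<subseteq> Z \<union> D" unfolding D_def Z_def by blast
    obtain B where B: "B \<subseteq> Z" "indep cl B" "Z \<subseteq> cl B" using basis[of "{}" Z] by auto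
    have "e \<notin> cl B" using eZ mono[OF B(1)] by blast
    then have "indep cl (insert e B)" by (rule indep_insert[OF B(2)])
    then obtain B' where B': "insert e B \<subseteq> B'" "B' \<subseteq> E - X" "indep cl B'" "E - X \<subseteq> cl B'"
      using basis[of "insert e B" "E - X"] B(1) eE(1,2) unfolding Z_def cl_dual_def by blast
    \<comment> \<open>An element of \<open>D\<close> in \<open>E\<close> is not spanned by the rest
      of \<open>E - X\<close>, so every base of \<open>E - X\<close> contains it. Thus
      \<open>B' - {e}\<close> spans \<open>D\<close> as well as \<open>Z\<close>, and therefore
      \<open>e\<close>.\<close>
    have "D \<inter> E \<subseteq> B'"
    proof (intro subsetI, rule ccontr)
      fix d assume d: "d \<in> D \<inter> E" "d \<notin> B'"
      then have "d \<notin> cl (E - X - {d})" unfolding D_def by (auto simp: cl_dual_def)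
      moreover have "B' \<subseteq> E - X - {d}" using B'(2) d(2) by blast
      moreover have "d \<in> cl B'" using d(1) B'(4) unfolding D_def by blast
      ultimately show False using mono by blast
    qed
    moreover have "e \<notin> D" using e(2) unfolding D_def by blast
    ultimately have "D \<subseteq> cl (B' - {e})" using ext[of "B' - {e}"] outE by blast
    moreover have "Z \<subseteq> cl (B' - {e})"
    proof -
      have "B \<subseteq> B' - {e}" using B'(1) B(1) unfolding Z_def by blast
      then show ?thesis using B(3) mono by blast
    qed
    ultimately have "e \<in> cl (B' - {e})" using cl_mem[OF eE(3)] cover by blast
    then show False using B'(1,3) unfolding indep_def by blast
  qed
  assume y: "y \<in> cl_dual E cl (insert x X)" "y \<notin> cl_dual E cl X"
  show "x \<in> cl_dual E cl (insert y X)"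
  proof (cases "x \<in> E \<and> x \<notin> X \<and> x \<noteq> y")
    case True
    define Z where "Z = E - insert x X - {y}"
    have y': "y \<in> E" "y \<notin> X" "y \<in> cl (E - X - {y})" using y(2) by (auto simp: cl_dual_def)
    have yZ: "y \<notin> cl Z" using y(1) y' True unfolding Z_def by (auto simp: cl_dual_def)
    have "E - X - {y} = insert x Z" using True unfolding Z_def by blast
    then have "y \<in> cl (insert x Z)" using y'(3) by simp
    have "x \<notin> cl Z"
    proof
      assume "x \<in> cl Z"
      then have "insert x Z \<subseteq> cl Z" using ext[of Z] by blast
      then show False using \<open>y \<in> cl (insert x Z)\<close> yZ cl_mem by blast
    qed
    moreover have "E - insert y X - {x} = Z" unfolding Z_def by blast
    ultimately show ?thesis unfolding cl_dual_def by simp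
  next
    case False
    then show ?thesis by (auto simp: cl_dual_def)
  qed
next
  fix I X assume I: "indep (cl_dual E cl) I" "I \<subseteq> X"
  have IE: "I \<subseteq> E" "cl (E - I) = UNIV" using I(1) unfolding indep_dual_iff by auto
  \<comment> \<open>A dual base of \<open>X\<close> is what a suitable base of the matroid leaves of
    \<open>X\<close>: start with a base of \<open>E - X\<close> and extend it while avoiding
    \<open>I\<close>.\<close>
  obtain A where A: "A \<subseteq> E - X" "indep cl A" "E - X \<subseteq> cl A" using basis[of "{}" "E - X"] by auto
  obtain A' where A': "A \<subseteq> A'" "A' \<subseteq> E - I" "indep cl A'" "E - I \<subseteq> cl A'"
    using basis[OF A(2), of "E - I"] A(1) I(2) by blast
  have A'U: "cl A' = UNIV" using IE(2) cl_least[OF A'(4)] by blast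
  define B where "B = X \<inter> E - A'"
  have "indep (cl_dual E cl) B"
    unfolding indep_dual_iff
  proof
    show "B \<subseteq> E" unfolding B_def by blast
    have "A' \<subseteq> E - B" using A'(2) unfolding B_def by blast
    then show "cl (E - B) = UNIV" using A'U mono by blast
  qed
  moreover have "X \<subseteq> cl_dual E cl B"
  proof (intro subsetI, rule ccontr)
    fix e assume e: "e \<in> X" "e \<notin> cl_dual E cl B"
    then have e': "e \<in> E" "e \<notin> B" "e \<in> cl (E - B - {e})" by (auto simp: cl_dual_def)
    then have eA: "e \<in> A'" using e(1) unfolding B_def by blast
    have "A \<subseteq> A' - {e}" using A(1) A'(1) e(1) by blast
    then have "E - X \<subseteq> cl (A' - {e})" using A(3) mono by blast
    moreover have "E - B - {e} \<subseteq> (E - X) \<union> (A' - {e})" unfolding B_def by blast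
    ultimately have "E - B - {e} \<subseteq> cl (A' - {e})" using ext[of "A' - {e}"] by blast
    then have "e \<in> cl (A' - {e})" by (rule cl_mem[OF e'(3)])
    then show False using A'(3) eA unfolding indep_def by blast
  qed
  moreover have "I \<subseteq> B" using I(2) IE(1) A'(2) unfolding B_def by blast
  ultimately show "\<exists>B. I \<subseteq> B \<and> B \<subseteq> X \<and> indep (cl_dual E cl) B \<and> X \<subseteq> cl_dual E cl B"
    unfolding B_def by (intro exI[of _ "X \<inter> E - A'"]) blast
qed

lemma loops_outside_dual: "loops_outside (cl_dual E cl) E"
  by (intro loops_outside.intro imatroid_dual loops_outside_axioms.intro) (auto simp: cl_dual_def)

text \<open>In terms of minors, \<open>I \<inter> S\<close> is independent in the contraction onto
  \<open>S\<close>, so its complement in \<open>S\<close> spans the dual restricted to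
  \<open>S\<close>.\<close>

lemma dual_spans:
  assumes "indep cl I" "- S \<subseteq> cl (I - S)"
  shows "S \<subseteq> cl_dual E cl (E \<inter> S - I)"
proof (intro subsetI, rule ccontr)
  fix e assume e: "e \<in> S" "e \<notin> cl_dual E cl (E \<inter> S - I)"
  then have e': "e \<in> E" "e \<in> I" "e \<in> cl (E - (E \<inter> S - I) - {e})" by (auto simp: cl_dual_def)
  have "I - S \<subseteq> I - {e}" using e(1) by blast
  then have "- S \<subseteq> cl (I - {e})" using assms(2) mono by blast
  then have "E - (E \<inter> S - I) - {e} \<subseteq> cl (I - {e})" using ext[of "I - {e}"] by blast
  then have "e \<in> cl (I - {e})" by (rule cl_mem[OF e'(3)])
  then show False using assms(1) e'(2) unfolding indep_def by blast
qed

text \<open>In terms of minors, \<open>I \<inter> S\<close> spans the restriction to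
  \<open>S\<close>, so its complement in \<open>S\<close> is independent in the dual contracted onto
  \<open>S\<close>.\<close>

lemma dual_indep:
  assumes "indep cl I" "S \<subseteq> cl (I \<inter> S)"
  shows "indep (cl_contract (cl_dual E cl) (- S)) (E \<inter> S - I)"
  unfolding indep_def cl_contract_def
proof
  fix a assume a: "a \<in> E \<inter> S - I"
  have "I \<inter> S \<subseteq> E - (E \<inter> S - I - {a} \<union> - S) - {a}" using a indep_ground[OF assms(1)] by blast
  then have "a \<in> cl (E - (E \<inter> S - I - {a} \<union> - S) - {a})" using a assms(2) mono by blast
  then show "a \<notin> cl_dual E cl (E \<inter> S - I - {a} \<union> - S)" using a unfolding cl_dual_def by blast
qed

end

text \<open>On \<open>R\<close> the complement of \<open>I\<close> is independent in the dual of
  \<open>f\<close> contracted onto \<open>R\<close> and spans \<open>R\<close> in the dual of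
  \<open>g\<close>; on \<open>- R\<close> the roles are exchanged. Thinning both halves to bases
  gives a solution with the sides of the partition swapped.\<close>

lemma has_intersection_dual:
  assumes "loops_outside f E" "loops_outside g E" "has_intersection f g"
  shows "has_intersection (cl_dual E f) (cl_dual E g)"
proof -
  interpret M: loops_outside f E by fact
  interpret N: loops_outside g E by fact
  interpret M': imatroid "cl_dual E f" by (rule M.imatroid_dual)
  interpret N': imatroid "cl_dual E g" by (rule N.imatroid_dual)
  interpret M'c: imatroid "cl_contract (cl_dual E f) (- R)" for R by (rule M'.imatroid_contract)
  interpret N'c: imatroid "cl_contract (cl_dual E g) R" for R by (rule N'.imatroid_contract)
  obtain I R where I: "indep f I" "indep g I" "R \<subseteq> f (I \<inter> R)" "- R \<subseteq> g (I - R)"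
    using assms(3) unfolding has_intersection_def by blast
  have I3: "- (- R) \<subseteq> f (I - (- R))" using I(3) by (simp add: Diff_eq)
  have I4: "- R \<subseteq> g (I \<inter> - R)" using I(4) by (simp add: Diff_eq)
  obtain J1 where J1: "J1 \<subseteq> E \<inter> R - I" "indep (cl_dual E g) J1" "E \<inter> R - I \<subseteq> cl_dual E g J1"
    using N'.basis[of "{}" "E \<inter> R - I"] by auto
  obtain J2 where J2: "J2 \<subseteq> E \<inter> - R - I" "indep (cl_dual E f) J2" "E \<inter> - R - I \<subseteq> cl_dual E f J2"
    using M'.basis[of "{}" "E \<inter> - R - I"] by auto
  have s1: "R \<subseteq> cl_dual E g J1" using N.dual_spans[OF I(2,4)] N'.cl_least[OF J1(3)] by blast
  have s2: "- R \<subseteq> cl_dual E f J2" using M.dual_spans[OF I(1) I3] M'.cl_least[OF J2(3)] by blast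
  have "indep (cl_contract (cl_dual E f) (- R)) J1" by (rule M'c.indep_subset[OF M.dual_indep[OF I(1,3)] J1(1)])
  then have "indep (cl_contract (cl_dual E f) J2) J1"
    by (rule M'.indep_contr_mono) (use J2(1) M'.ext[of "- R"] in blast)
  then have i1: "indep (cl_dual E f) (J2 \<union> J1)" by (rule M'.indep_Un[OF J2(2)])
  have "indep (cl_contract (cl_dual E g) (- (- R))) J2"
    using N'c.indep_subset[of "- (- R)", OF N.dual_indep[OF I(2) I4] J2(1)] .
  then have "indep (cl_contract (cl_dual E g) J1) J2"
    by (rule N'.indep_contr_mono) (use J1(1) N'.ext[of "- (- R)"] in blast)
  then have i2: "indep (cl_dual E g) (J1 \<union> J2)" by (rule N'.indep_Un[OF J1(2)])
  show ?thesis
    unfolding has_intersection_def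
  proof (intro exI conjI)
    show "indep (cl_dual E f) (J1 \<union> J2)" using i1 by (simp add: Un_commute)
    show "indep (cl_dual E g) (J1 \<union> J2)" by (rule i2)
    show "- R \<subseteq> cl_dual E f ((J1 \<union> J2) \<inter> - R)"
      using s2 M'.mono[of J2 "(J1 \<union> J2) \<inter> - R"] J2(1) by blast
    show "- (- R) \<subseteq> cl_dual E g (J1 \<union> J2 - (- R))"
      using s1 N'.mono[of J1 "J1 \<union> J2 - (- R)"] J1(1) by blast
  qed
qed

section \<open>Closure operators of matroids given by independent sets\<close>

definition matroid_cl :: "'a matroid \<Rightarrow> 'a set \<Rightarrow> 'a set" where
  "matroid_cl M X = {e. e \<in> X \<or> e \<notin> ground M \<or> (\<exists>I\<in>indeps M. I \<subseteq> X \<and> insert e I \<notin> indeps M)}"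

definition represents :: "('a set \<Rightarrow> 'a set) \<Rightarrow> 'a matroid \<Rightarrow> bool" where
  "represents f M \<longleftrightarrow> loops_outside f (ground M) \<and> (\<forall>I. I \<in> indeps M \<longleftrightarrow> indep f I)"

lemma representsD:
  assumes "represents f M"
  shows "loops_outside f (ground M)" and "I \<in> indeps M \<longleftrightarrow> indep f I"
  using assms unfolding represents_def by blast+

lemma maximal_inD:
  assumes "maximal_in F J"
  shows "J \<in> F" "\<And>K. K \<in> F \<Longrightarrow> J \<subseteq> K \<Longrightarrow> K = J"
  using assms unfolding maximal_in_def by blast+

locale matroid_ax =
  fixes M :: "'a matroid"
  assumes M: "matroid M"
begin

lemma ind_ground: "I \<in> indeps M \<Longrightarrow> I \<subseteq> ground M"
proof -
  have "indeps M \<subseteq> Pow (ground M)" using M unfolding matroid_def by (elim conjE)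
  then show "I \<in> indeps M \<Longrightarrow> I \<subseteq> ground M" by blast
qed

lemma ind_empty: "{} \<in> indeps M"
  using M unfolding matroid_def by (elim conjE)

lemma ind_subset: "I \<in> indeps M \<Longrightarrow> J \<subseteq> I \<Longrightarrow> J \<in> indeps M"
proof -
  have "\<forall>I\<in>indeps M. \<forall>J. J \<subseteq> I \<longrightarrow> J \<in> indeps M" using M unfolding matroid_def by (elim conjE)
  then show "I \<in> indeps M \<Longrightarrow> J \<subseteq> I \<Longrightarrow> J \<in> indeps M" by blast
qed

lemma ind_exchange:
  assumes "I \<in> indeps M" "maximal_in (indeps M) J" "\<not> maximal_in (indeps M) I"
  shows "\<exists>e\<in>J - I. insert e I \<in> indeps M"
proof -
  have "\<forall>I\<in>indeps M. \<forall>J\<in>indeps M. maximal_in (indeps M) J \<and> \<not> maximal_in (indeps M) I \<longrightarrow> (\<exists>e\<in>J - I. insert e I \<in> indeps M)"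
    using M unfolding matroid_def by (elim conjE)
  then show ?thesis using assms maximal_inD(1)[OF assms(2)] by blast
qed

lemma ind_extend:
  assumes "X \<subseteq> ground M" "I \<in> indeps M" "I \<subseteq> X"
  obtains J where "I \<subseteq> J" "maximal_in (indeps M \<inter> Pow X) J"
proof -
  have "\<forall>X. X \<subseteq> ground M \<longrightarrow> (\<forall>I\<in>indeps M \<inter> Pow X. \<exists>J. I \<subseteq> J \<and> maximal_in (indeps M \<inter> Pow X) J)"
    using M unfolding matroid_def by (elim conjE)
  then have "\<exists>J. I \<subseteq> J \<and> maximal_in (indeps M \<inter> Pow X) J" using assms by simp
  then show ?thesis using that by (elim exE conjE)
qed

text \<open>Axiom (3) concerns bases of the whole matroid, so complete \<open>J\<close> to a base
  \<open>J'\<close> with new part \<open>Z\<close>. If no element of \<open>J\<close> extends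
  \<open>I\<close>, then \<open>I\<close> grows to a base \<open>I'\<close> inside
  \<open>I \<union> Z\<close>, and \<open>insert x I\<close> grows to a base \<open>I''\<close>
  missing some \<open>a\<close> of \<open>I'\<close> in \<open>Z\<close>. Exchanging
  \<open>a\<close> out of \<open>J'\<close> brings in an element of \<open>X\<close>, against the
  maximality of \<open>J\<close>.\<close>

lemma restrict_exchange:
  assumes X: "X \<subseteq> ground M" and I: "I \<in> indeps M" "I \<subseteq> X" and J: "maximal_in (indeps M \<inter> Pow X) J"
    and x: "x \<in> X - I" "insert x I \<in> indeps M"
  shows "\<exists>e\<in>J - I. insert e I \<in> indeps M"
proof (rule ccontr)
  assume "\<not> (\<exists>e\<in>J - I. insert e I \<in> indeps M)"
  then have no: "\<And>e. e \<in> J \<Longrightarrow> e \<notin> I \<Longrightarrow> insert e I \<notin> indeps M" by blast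
  have J1: "J \<in> indeps M" "J \<subseteq> X" using maximal_inD(1)[OF J] by auto
  obtain J' where J': "J \<subseteq> J'" "maximal_in (indeps M \<inter> Pow (ground M)) J'"
    using ind_extend[of "ground M" J] J1 ind_ground by blast
  have EE: "indeps M \<inter> Pow (ground M) = indeps M" using ind_ground by blast
  have bJ': "maximal_in (indeps M) J'" and J'i: "J' \<in> indeps M" using J'(2) maximal_inD(1)[OF J'(2)] EE by auto
  have "J' \<inter> X \<in> indeps M \<inter> Pow X" using ind_subset[OF J'i, of "J' \<inter> X"] by blast
  then have J'X: "J' \<inter> X = J" using maximal_inD(2)[OF J, of "J' \<inter> X"] J'(1) J1(2) by blast
  define Z where "Z = J' - X"
  have ZE: "I \<union> Z \<subseteq> ground M" "insert x I \<union> Z \<subseteq> ground M"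
    using ind_ground[OF J'i] ind_ground[OF x(2)] unfolding Z_def by blast+
  obtain I' where I': "I \<subseteq> I'" "maximal_in (indeps M \<inter> Pow (I \<union> Z)) I'"
    using ind_extend[OF ZE(1) I(1)] by blast
  have I'i: "I' \<in> indeps M" "I' \<subseteq> I \<union> Z" using maximal_inD(1)[OF I'(2)] by auto
  have bI': "maximal_in (indeps M) I'"
  proof (rule ccontr)
    assume "\<not> maximal_in (indeps M) I'"
    then obtain e where e: "e \<in> J' - I'" "insert e I' \<in> indeps M" using ind_exchange[OF I'i(1) bJ'] by blast
    show False
    proof (cases "e \<in> X")
      case True
      then have "e \<in> J" "e \<notin> I" using e(1) J'X I'(1) by blast+
      moreover have "insert e I \<in> indeps M" by (rule ind_subset[OF e(2)]) (use I'(1) in blast)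
      ultimately show False using no by blast
    next
      case False
      then have "insert e I' \<in> indeps M \<inter> Pow (I \<union> Z)" using e I'i(2) unfolding Z_def by blast
      then show False using maximal_inD(2)[OF I'(2), of "insert e I'"] e(1) by blast
    qed
  qed
  have sub: "insert x I \<union> (I' - I) \<subseteq> ground M" using ZE I'i(2) by blast
  obtain I'' where I'': "insert x I \<subseteq> I''" "maximal_in (indeps M \<inter> Pow (insert x I \<union> (I' - I))) I''"
    using ind_extend[OF sub x(2)] by blast
  have I''i: "I'' \<in> indeps M" "I'' \<subseteq> insert x I \<union> (I' - I)" using maximal_inD(1)[OF I''(2)] by auto
  have bI'': "maximal_in (indeps M) I''"
  proof (rule ccontr)
    assume "\<not> maximal_in (indeps M) I''"
    then obtain e where e: "e \<in> I' - I''" "insert e I'' \<in> indeps M" using ind_exchange[OF I''i(1) bI'] by blast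
    then have "insert e I'' \<in> indeps M \<inter> Pow (insert x I \<union> (I' - I))" using I''(1) I''i(2) by blast
    then show False using maximal_inD(2)[OF I''(2), of "insert e I''"] e(1) by blast
  qed
  have "x \<notin> I'" using x(1) I'i(2) unfolding Z_def by blast
  then have "\<not> I' \<subseteq> I''" using maximal_inD(2)[OF bI' I''i(1)] I''(1) by blast
  then obtain a where a: "a \<in> I'" "a \<notin> I''" by blast
  then have aZ: "a \<in> J'" "a \<notin> X" using I'i(2) I''(1) unfolding Z_def by blast+
  have Ja: "J' - {a} \<in> indeps M" by (rule ind_subset[OF J'i]) blast
  have "\<not> maximal_in (indeps M) (J' - {a})" using maximal_inD(2)[OF _ J'i, of "J' - {a}"] aZ(1) by blast
  then obtain e where e: "e \<in> I'' - (J' - {a})" "insert e (J' - {a}) \<in> indeps M"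
    using ind_exchange[OF Ja bI''] by blast
  have "e \<noteq> a" using e(1) a(2) by blast
  then have eJ': "e \<notin> J'" using e(1) by blast
  have "e \<in> X" using e(1) I''i(2) I'i(2) I(2) x(1) eJ' unfolding Z_def by blast
  moreover have "insert e J \<in> indeps M"
    by (rule ind_subset[OF e(2)]) (use J'(1) J1(2) aZ(2) in blast)
  ultimately have "insert e J = J" using maximal_inD(2)[OF J, of "insert e J"] J1(2) by blast
  then show False using eJ' J'(1) by blast
qed

text \<open>Any base of \<open>X\<close> thus decides whether \<open>X\<close> spans
  \<open>e\<close>. An extension \<open>J\<close> of \<open>I\<close> maximal in \<open>X\<close> is
  also maximal in \<open>insert e X\<close>, so if \<open>insert e B\<close> were independent,
  \<open>restrict_exchange\<close> would enlarge \<open>B\<close> by an element of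
  \<open>J\<close>.\<close>

lemma maximal_dependent:
  assumes X: "X \<subseteq> ground M" and B: "maximal_in (indeps M \<inter> Pow X) B" and e: "e \<in> ground M - X"
    and I: "I \<in> indeps M" "I \<subseteq> X" "insert e I \<notin> indeps M"
  shows "insert e B \<notin> indeps M"
proof
  assume eB: "insert e B \<in> indeps M"
  have B1: "B \<in> indeps M" "B \<subseteq> X" using maximal_inD(1)[OF B] by auto
  obtain J where J: "I \<subseteq> J" "maximal_in (indeps M \<inter> Pow X) J" using ind_extend[OF X I(1,2)] by blast
  have J1: "J \<in> indeps M" "J \<subseteq> X" using maximal_inD(1)[OF J(2)] by auto
  have "maximal_in (indeps M \<inter> Pow (insert e X)) J"
    unfolding maximal_in_def
  proof (intro conjI ballI impI)
    show "J \<in> indeps M \<inter> Pow (insert e X)" using J1 by blast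
    fix K assume K: "K \<in> indeps M \<inter> Pow (insert e X)" "J \<subseteq> K"
    have "e \<notin> K"
    proof
      assume "e \<in> K"
      then have "insert e I \<subseteq> K" using K(2) J(1) by blast
      then show False using ind_subset[of K] K(1) I(3) by blast
    qed
    then show "K = J" using maximal_inD(2)[OF J(2), of K] K by blast
  qed
  moreover have "insert e X \<subseteq> ground M" "B \<subseteq> insert e X" "e \<in> insert e X - B" using X e B1(2) by blast+
  ultimately obtain f where f: "f \<in> J - B" "insert f B \<in> indeps M"
    using restrict_exchange[of "insert e X" B J e] B1(1) eB by blast
  then have "insert f B = B" using maximal_inD(2)[OF B, of "insert f B"] B1(2) J1(2) by blast
  then show False using f(1) by blast
qed

lemma matroid_cl_eq:
  assumes "maximal_in (indeps M \<inter> Pow (X \<inter> ground M)) B"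
  shows "matroid_cl M X = {e. e \<in> X \<or> e \<notin> ground M \<or> insert e B \<notin> indeps M}"
proof -
  have B: "B \<in> indeps M" "B \<subseteq> X" using maximal_inD(1)[OF assms] by auto
  have "insert e B \<notin> indeps M" if "e \<notin> X" "e \<in> ground M" "I \<in> indeps M" "I \<subseteq> X" "insert e I \<notin> indeps M" for e I
    by (rule maximal_dependent[OF _ assms, of e I]) (use that ind_ground in blast)+
  then show ?thesis unfolding matroid_cl_def using B by blast
qed

lemma maximal_exists:
  assumes "I \<in> indeps M" "I \<subseteq> X"
  obtains B where "I \<subseteq> B" "maximal_in (indeps M \<inter> Pow (X \<inter> ground M)) B"
proof -
  have "X \<inter> ground M \<subseteq> ground M" "I \<subseteq> X \<inter> ground M" using assms(2) ind_ground[OF assms(1)] by blast+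
  then show ?thesis using ind_extend[OF _ assms(1)] that by metis
qed

lemma indep_matroid_cl_iff: "I \<in> indeps M \<longleftrightarrow> indep (matroid_cl M) I"
proof
  assume I: "I \<in> indeps M"
  show "indep (matroid_cl M) I"
    unfolding indep_def
  proof (intro ballI notI)
    fix a assume a: "a \<in> I" "a \<in> matroid_cl M (I - {a})"
    then obtain J where J: "J \<subseteq> I - {a}" "insert a J \<notin> indeps M" using ind_ground[OF I] unfolding matroid_cl_def by blast
    then have "insert a J \<subseteq> I" using a(1) by blast
    then show False using ind_subset[OF I] J(2) by blast
  qed
next
  assume I: "indep (matroid_cl M) I"
  have IE: "I \<subseteq> ground M" using I unfolding indep_def matroid_cl_def by blast
  obtain B where B: "maximal_in (indeps M \<inter> Pow (I \<inter> ground M)) B" using maximal_exists[OF ind_empty, of I] by blast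
  have B1: "B \<in> indeps M" "B \<subseteq> I" using maximal_inD(1)[OF B] by auto
  have "I \<subseteq> B"
  proof (intro subsetI, rule ccontr)
    fix a assume a: "a \<in> I" "a \<notin> B"
    have "insert a B \<notin> indeps M" using maximal_inD(2)[OF B, of "insert a B"] a B1(2) IE by blast
    then have "a \<in> matroid_cl M (I - {a})" unfolding matroid_cl_def using B1 a(2) by blast
    then show False using I a(1) unfolding indep_def by blast
  qed
  then show "I \<in> indeps M" using B1 by (metis subset_antisym)
qed

lemma imatroid_matroid_cl: "imatroid (matroid_cl M)"
proof unfold_locales
  fix X Y :: "'a set" and x y :: 'a
  show ext: "X \<subseteq> matroid_cl M X" for X unfolding matroid_cl_def by blast
  show mono: "X \<subseteq> Y \<Longrightarrow> matroid_cl M X \<subseteq> matroid_cl M Y" for X Y unfolding matroid_cl_def by blast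
  show idem: "matroid_cl M (matroid_cl M X) \<subseteq> matroid_cl M X" for X
  proof -
    obtain B where B: "maximal_in (indeps M \<inter> Pow (X \<inter> ground M)) B" using maximal_exists[OF ind_empty, of X] by blast
    have B1: "B \<in> indeps M" "B \<subseteq> X \<inter> ground M" using maximal_inD(1)[OF B] by auto
    \<comment> \<open>A base of \<open>X\<close> is still a base of the closure, so both closures
      are computed from the same \<open>B\<close>.\<close>
    have "maximal_in (indeps M \<inter> Pow (matroid_cl M X \<inter> ground M)) B"
      unfolding maximal_in_def
    proof (intro conjI ballI impI)
      show "B \<in> indeps M \<inter> Pow (matroid_cl M X \<inter> ground M)" using B1 ext[of X] by blast
      fix K assume K: "K \<in> indeps M \<inter> Pow (matroid_cl M X \<inter> ground M)" "B \<subseteq> K"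
      have "k \<in> X" if "k \<in> K" for k
      proof (rule ccontr)
        assume "k \<notin> X"
        then have "insert k B \<notin> indeps M" using that K(1) matroid_cl_eq[OF B] by blast
        then show False using ind_subset[of K "insert k B"] K that by blast
      qed
      then show "K = B" using maximal_inD(2)[OF B, of K] K by blast
    qed
    from matroid_cl_eq[OF this] show ?thesis using matroid_cl_eq[OF B] by blast
  qed
  assume y: "y \<in> matroid_cl M (insert x X)" "y \<notin> matroid_cl M X"
  show "x \<in> matroid_cl M (insert y X)"
  proof (cases "x \<in> ground M \<and> x \<noteq> y \<and> x \<notin> matroid_cl M X")
    case True
    obtain B where B: "maximal_in (indeps M \<inter> Pow (X \<inter> ground M)) B" using maximal_exists[OF ind_empty, of X] by blast
    have B1: "B \<in> indeps M" "B \<subseteq> X \<inter> ground M" using maximal_inD(1)[OF B] by auto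
    have yB: "insert y B \<in> indeps M" and xB: "insert x B \<in> indeps M" using y(2) True matroid_cl_eq[OF B] by blast+
    have "maximal_in (indeps M \<inter> Pow (insert x X \<inter> ground M)) (insert x B)"
      unfolding maximal_in_def
    proof (intro conjI ballI impI)
      show "insert x B \<in> indeps M \<inter> Pow (insert x X \<inter> ground M)" using B1 xB True by blast
      fix K assume K: "K \<in> indeps M \<inter> Pow (insert x X \<inter> ground M)" "insert x B \<subseteq> K"
      have "K - {x} \<in> indeps M \<inter> Pow (X \<inter> ground M)" using K(1) ind_subset[of K "K - {x}"] by blast
      moreover have "B \<subseteq> K - {x}" using K(2) B1(2) True ext[of X] by blast
      ultimately have "K - {x} = B" by (rule maximal_inD(2)[OF B])
      then show "K = insert x B" using K(2) by blast
    qed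
    from matroid_cl_eq[OF this] have "y \<in> insert x X \<or> y \<notin> ground M \<or> insert y (insert x B) \<notin> indeps M"
      using y(1) by blast
    moreover have "y \<notin> X" "y \<in> ground M" using y(2) unfolding matroid_cl_def by blast+
    ultimately have "insert y (insert x B) \<notin> indeps M" using True by blast
    then have "insert x (insert y B) \<notin> indeps M" by (simp add: insert_commute)
    then show ?thesis unfolding matroid_cl_def using yB B1(2) by blast
  next
    case False
    have "x \<notin> matroid_cl M X"
    proof
      assume "x \<in> matroid_cl M X"
      then have "matroid_cl M (insert x X) \<subseteq> matroid_cl M (matroid_cl M X)" using ext[of X] by (intro mono) blast
      then show False using y idem[of X] by blast
    qed
    then show ?thesis using False y unfolding matroid_cl_def by blast
  qed
next
  fix I X assume I: "indep (matroid_cl M) I" "I \<subseteq> X"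
  have "I \<in> indeps M" using I(1) by (simp only: indep_matroid_cl_iff)
  then obtain B where B: "I \<subseteq> B" "maximal_in (indeps M \<inter> Pow (X \<inter> ground M)) B"
    by (rule maximal_exists[OF _ I(2)])
  have B1: "B \<in> indeps M" "B \<subseteq> X" using maximal_inD(1)[OF B(2)] by auto
  have "X \<subseteq> matroid_cl M B"
  proof (intro subsetI, rule ccontr)
    fix x assume x: "x \<in> X" "x \<notin> matroid_cl M B"
    then have "x \<in> ground M" "x \<notin> B" "insert x B \<in> indeps M" using B1(1) unfolding matroid_cl_def by blast+
    then show False using maximal_inD(2)[OF B(2), of "insert x B"] B1(2) x(1) ind_ground[OF B1(1)] by blast
  qed
  then show "\<exists>B. I \<subseteq> B \<and> B \<subseteq> X \<and> indep (matroid_cl M) B \<and> X \<subseteq> matroid_cl M B"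
    using B(1) B1 by (intro exI[of _ B]) (simp add: indep_matroid_cl_iff[symmetric])
qed

lemma represents_matroid_cl: "represents (matroid_cl M) M"
proof -
  have "- (ground M) \<subseteq> matroid_cl M {}" unfolding matroid_cl_def by blast
  then have "loops_outside (matroid_cl M) (ground M)"
    by (intro loops_outside.intro imatroid_matroid_cl loops_outside_axioms.intro)
  then show ?thesis unfolding represents_def by (intro conjI allI indep_matroid_cl_iff)
qed

end

section \<open>Bases, duals, minors and finitarizations through closure operators\<close>

lemma base_iff:
  assumes "represents f M"
  shows "base M B \<longleftrightarrow> indep f B \<and> f B = UNIV"
proof -
  interpret loops_outside f "ground M" by (rule representsD(1)[OF assms])
  note ind = representsD(2)[OF assms]
  show ?thesis
  proof
    assume "base M B"
    then have m: "maximal_in (indeps M) B" by (simp only: base_def)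
    have B: "indep f B" using maximal_inD(1)[OF m] by (simp only: ind)
    have max: "K = B" if "indep f K" "B \<subseteq> K" for K
      using maximal_inD(2)[OF m, of K] that by (simp only: ind)
    have "x \<in> f B" for x
    proof (rule ccontr)
      assume n: "x \<notin> f B"
      then have "insert x B = B" using max[OF indep_insert[OF B n]] by blast
      then show False using n ext[of B] by blast
    qed
    then show "indep f B \<and> f B = UNIV" using B by blast
  next
    assume B: "indep f B \<and> f B = UNIV"
    have "K = B" if K: "indep f K" "B \<subseteq> K" for K
    proof (rule ccontr)
      assume "K \<noteq> B"
      then obtain k where k: "k \<in> K" "k \<notin> B" using K(2) by blast
      then have "B \<subseteq> K - {k}" using K(2) by blast
      then have "k \<in> f (K - {k})" using B mono by blast
      then show False using K(1) k(1) unfolding indep_def by blast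
    qed
    then show "base M B" unfolding base_def maximal_in_def Ball_def ind using B by blast
  qed
qed

lemma represents_dual:
  assumes "represents f M"
  shows "represents (cl_dual (ground M) f) (matroid_dual M)"
proof -
  interpret loops_outside f "ground M" by (rule representsD(1)[OF assms])
  have "I \<in> indeps (matroid_dual M) \<longleftrightarrow> indep (cl_dual (ground M) f) I" for I
  proof
    assume "I \<in> indeps (matroid_dual M)"
    then obtain B where B: "indep f B" "f B = UNIV" "I \<subseteq> ground M - B"
      unfolding matroid_dual_def base_iff[OF assms] by auto
    have "B \<subseteq> ground M - I" using indep_ground[OF B(1)] B(3) by blast
    then show "indep (cl_dual (ground M) f) I" unfolding indep_dual_iff using B mono by blast
  next
    assume "indep (cl_dual (ground M) f) I"
    then have I: "I \<subseteq> ground M" "f (ground M - I) = UNIV" unfolding indep_dual_iff by auto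
    obtain B where B: "B \<subseteq> ground M - I" "indep f B" "ground M - I \<subseteq> f B"
      using basis[of "{}" "ground M - I"] by auto
    have "f B = UNIV" using I(2) cl_least[OF B(3)] by blast
    then show "I \<in> indeps (matroid_dual M)"
      unfolding matroid_dual_def base_iff[OF assms] using B I(1) by auto
  qed
  then show ?thesis using loops_outside_dual unfolding represents_def by (simp add: matroid_dual_def)
qed

lemma represents_restrict:
  assumes "represents f M" "W \<subseteq> ground M"
  shows "represents (cl_delete f (- W)) (matroid_restrict M W)"
proof -
  interpret loops_outside f "ground M" by (rule representsD(1)[OF assms(1)])
  have "I \<in> indeps (matroid_restrict M W) \<longleftrightarrow> indep (cl_delete f (- W)) I" for I
    using representsD(2)[OF assms(1)] unfolding matroid_restrict_def indep_delete by auto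
  moreover have "loops_outside (cl_delete f (- W)) W"
    by (intro loops_outside.intro imatroid_delete loops_outside_axioms.intro) (auto simp: cl_delete_def)
  ultimately show ?thesis unfolding represents_def by (simp add: matroid_restrict_def)
qed

lemma represents_contract_onto:
  assumes "represents f M" "W \<subseteq> ground M"
  shows "represents (cl_contract f (- W)) (contract_onto M W)"
proof -
  interpret loops_outside f "ground M" by (rule representsD(1)[OF assms(1)])
  let ?E = "ground M"
  have g: "ground (matroid_dual M) = ?E" by (simp add: matroid_dual_def)
  have "?E - (?E - W) = W" using assms(2) by blast
  then have eq: "contract_onto M W = matroid_dual (matroid_restrict (matroid_dual M) W)"
    unfolding contract_onto_def matroid_contract_def matroid_delete_def g by simp
  have "represents (cl_dual W (cl_delete (cl_dual ?E f) (- W))) (contract_onto M W)"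
    using represents_dual[OF represents_restrict[OF represents_dual[OF assms(1)], of W]] assms(2) g
    unfolding eq by (simp add: matroid_restrict_def)
  \<comment> \<open>The two complements cancel. Elements outside the ground set are loops, so
    contracting \<open>- W\<close> has the effect of contracting
    \<open>ground M - W\<close>.\<close>
  moreover have "cl_dual W (cl_delete (cl_dual ?E f) (- W)) = cl_contract f (- W)"
  proof (rule HOL.ext)
    fix X
    have "e \<in> cl_dual W (cl_delete (cl_dual ?E f) (- W)) X \<longleftrightarrow> e \<in> f (X \<union> - W)" for e
    proof (cases "e \<in> W \<and> e \<notin> X")
      case True
      have "f (?E - (W - X - {e}) - {e}) = f (X \<union> - W)"
      proof (rule cl_eqI)
        have "?E - (W - X - {e}) - {e} \<subseteq> X \<union> - W" by blast
        then show "?E - (W - X - {e}) - {e} \<subseteq> f (X \<union> - W)" using ext by blast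
        have "(X \<union> - W) \<inter> ?E \<subseteq> ?E - (W - X - {e}) - {e}" using True by blast
        then show "X \<union> - W \<subseteq> f (?E - (W - X - {e}) - {e})"
          using ext[of "?E - (W - X - {e}) - {e}"] outE by blast
      qed
      moreover have "W - X - {e} - (- W) = W - X - {e}" by blast
      ultimately show ?thesis using True assms(2) by (auto simp: cl_dual_def cl_delete_def)
    next
      case False
      then have "e \<in> f (X \<union> - W)" using ext[of "X \<union> - W"] by blast
      then show ?thesis using False by (auto simp: cl_dual_def)
    qed
    then show "cl_dual W (cl_delete (cl_dual ?E f) (- W)) X = cl_contract f (- W) X" unfolding cl_contract_def by blast
  qed
  ultimately show ?thesis by simp
qed

lemma represents_finitarization:
  assumes "represents f M"
  shows "represents (cl_fin f) (finitarization M)"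
proof -
  interpret loops_outside f "ground M" by (rule representsD(1)[OF assms])
  interpret F: imatroid "cl_fin f" by (rule imatroid_fin)
  note ind = representsD(2)[OF assms]
  have out': "- ground M \<subseteq> cl_fin f {}"
    using out unfolding cl_fin_def by blast
  then interpret F: loops_outside "cl_fin f" "ground M" by unfold_locales
  have "I \<in> indeps (finitarization M) \<longleftrightarrow> indep (cl_fin f) I" for I
  proof
    assume "I \<in> indeps (finitarization M)"
    then have I: "I \<subseteq> ground M" "\<And>C. circuit M C \<Longrightarrow> finite C \<Longrightarrow> \<not> C \<subseteq> I"
      unfolding finitarization_def by auto
    show "indep (cl_fin f) I"
      unfolding indep_def
    proof (intro ballI notI)
      fix a assume a: "a \<in> I" "a \<in> cl_fin f (I - {a})"
      then obtain F where F: "F \<subseteq> I - {a}" "finite F" "a \<in> f F" unfolding cl_fin_def by blast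
      \<comment> \<open>A minimal dependent subset of the finite set \<open>insert a F\<close> is a
        finite circuit.\<close>
      define D where "D = {D. D \<subseteq> insert a F \<and> \<not> indep f D}"
      have "F \<subseteq> insert a F - {a}" using F(1) by blast
      then have "insert a F \<in> D" unfolding D_def indep_def using F(3) mono by blast
      moreover have "finite D" unfolding D_def using F(2) by simp
      ultimately obtain C where C: "C \<in> D" "\<And>C'. C' \<in> D \<Longrightarrow> C' \<subseteq> C \<Longrightarrow> C' = C"
        using finite_has_minimal[of D] by blast
      have CF: "C \<subseteq> insert a F" using C(1) unfolding D_def by blast
      then have CI: "C \<subseteq> I" using F(1) a(1) by blast
      have "circuit M C"
        unfolding circuit_def ind
      proof (intro conjI allI impI)
        show "C \<subseteq> ground M" using CI I(1) by (rule subset_trans)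
        show "\<not> indep f C" using C(1) unfolding D_def by blast
        show "C' = C" if "C' \<subseteq> C \<and> \<not> indep f C'" for C'
          using C(2)[of C'] that CF unfolding D_def by blast
      qed
      moreover have "finite C" using CF F(2) finite_subset by blast
      ultimately show False using I(2) CI by blast
    qed
  next
    assume I: "indep (cl_fin f) I"
    have "False" if C: "circuit M C" "finite C" "C \<subseteq> I" for C
    proof -
      have "\<not> indep f C" using C(1) unfolding circuit_def ind by blast
      then obtain c where c: "c \<in> C" "c \<in> f (C - {c})" unfolding indep_def by blast
      have "C - {c} \<subseteq> I - {c}" "finite (C - {c})" using C by auto
      then have "c \<in> cl_fin f (I - {c})" unfolding cl_fin_def using c(2) by blast
      then show False using I c(1) C(3) unfolding indep_def by blast
    qed
    then show "I \<in> indeps (finitarization M)"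
      unfolding finitarization_def using F.indep_ground[OF I] by auto
  qed
  then show ?thesis unfolding represents_def using F.loops_outside_axioms by (simp add: finitarization_def)
qed

lemma nearly_finitary_closure:
  assumes "represents f M" "nearly_finitary M" "indep f B" "f B = UNIV"
  shows "\<exists>F. finite F \<and> cl_fin f (B \<union> F) = UNIV"
  using assms(2-4) unfolding nearly_finitary_def base_iff[OF assms(1)]
    base_iff[OF represents_finitarization[OF assms(1)]] by blast

lemma cond_iff:
  assumes "represents f M" "represents g N" "ground N = ground M"
  shows "cond M N \<longleftrightarrow> (\<forall>W. W \<subseteq> ground M \<longrightarrow>
    (\<exists>B. B \<subseteq> W \<and> indep f B \<and> W \<subseteq> f B \<and> indep (cl_contract g (- W)) B) \<longrightarrow>
    (\<exists>B. B \<subseteq> W \<and> indep (cl_contract g (- W)) B \<and> g (B \<union> - W) = UNIV \<and> indep f B))"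
proof -
  have r: "base (matroid_restrict M W) B \<longleftrightarrow> B \<subseteq> W \<and> indep f B \<and> W \<subseteq> f B"
    "B \<in> indeps (matroid_restrict M W) \<longleftrightarrow> B \<subseteq> W \<and> indep f B"
    "base (contract_onto N W) B \<longleftrightarrow> indep (cl_contract g (- W)) B \<and> g (B \<union> - W) = UNIV"
    "B \<in> indeps (contract_onto N W) \<longleftrightarrow> indep (cl_contract g (- W)) B" if W: "W \<subseteq> ground M" for W B
  proof -
    show "base (matroid_restrict M W) B \<longleftrightarrow> B \<subseteq> W \<and> indep f B \<and> W \<subseteq> f B"
    proof (cases "B \<subseteq> W")
      case True
      then have "B \<inter> - W = {}" "B - (- W) = B" by blast+
      then show ?thesis
        unfolding base_iff[OF represents_restrict[OF assms(1) W]] indep_delete cl_delete_def using True by auto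
    next
      case False
      then have "B \<inter> - W \<noteq> {}" by blast
      then show ?thesis
        unfolding base_iff[OF represents_restrict[OF assms(1) W]] indep_delete using False by simp
    qed
    show "B \<in> indeps (matroid_restrict M W) \<longleftrightarrow> B \<subseteq> W \<and> indep f B"
      using representsD(2)[OF assms(1)] unfolding matroid_restrict_def by auto
    have rc: "represents (cl_contract g (- W)) (contract_onto N W)"
      using represents_contract_onto[OF assms(2), of W] W assms(3) by simp
    show "base (contract_onto N W) B \<longleftrightarrow> indep (cl_contract g (- W)) B \<and> g (B \<union> - W) = UNIV"
      unfolding base_iff[OF rc] by (simp add: cl_contract_def)
    show "B \<in> indeps (contract_onto N W) \<longleftrightarrow> indep (cl_contract g (- W)) B"
      by (rule representsD(2)[OF rc])
  qed
  show ?thesis unfolding cond_def by (intro all_cong1 imp_cong) (auto simp: r)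
qed

section \<open>Nearly finitary and nearly cofinitary matroids\<close>

theorem nearly_finitary_intersection:
  assumes M: "represents f M" "ground M = E" and N: "represents g N" "ground N = E"
    and count: "countable E"
    and nM: "nearly_finitary M \<or> nearly_cofinitary M"
    and nN: "nearly_finitary N \<or> nearly_cofinitary N"
  shows "has_intersection f g"
proof -
  have near: "has_intersection (cl_fin h) k \<Longrightarrow> has_intersection h k"
    if "represents h L" "nearly_finitary L" "imatroid k" for h k :: "'a set \<Rightarrow> 'a set" and L
  proof -
    have "imatroid h" using representsD(1)[OF that(1)] unfolding loops_outside_def by blast
    then interpret matroid_pair h k using that(3) by (intro matroid_pair.intro)
    show "has_intersection (cl_fin h) k \<Longrightarrow> has_intersection h k"
      by (rule has_intersection_nearly_finitary[OF nearly_finitary_closure[OF that(1,2)]])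
  qed
  have fini: "loops_outside (cl_fin h) E"
    if "represents h L" "ground L = E" for h :: "'a set \<Rightarrow> 'a set" and L
    using representsD(1)[OF represents_finitarization[OF that(1)]] that(2)
    unfolding finitarization_def by simp
  have dl: "represents (cl_dual E h) (matroid_dual L)" "ground (matroid_dual L) = E" "cl_dual E (cl_dual E h) = h"
    "loops_outside h E" if "represents h L" "ground L = E" for h :: "'a set \<Rightarrow> 'a set" and L
  proof -
    show lo: "loops_outside h E" using representsD(1)[OF that(1)] that(2) by simp
    show "represents (cl_dual E h) (matroid_dual L)" using represents_dual[OF that(1)] that(2) by simp
    show "ground (matroid_dual L) = E" using that(2) by (simp add: matroid_dual_def)
    show "cl_dual E (cl_dual E h) = h"
      using lo by (intro dual_dual) (auto simp: loops_outside_def loops_outside_axioms_def)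
  qed
  have im: "imatroid h" if "loops_outside h E" for h :: "'a set \<Rightarrow> 'a set"
    using that unfolding loops_outside_def by blast
  \<comment> \<open>Solve for both finitarizations, then return to the matroids one after the other,
    using symmetry for the second.\<close>
  have ff: "has_intersection h k"
    if h: "represents h L" "ground L = E" "nearly_finitary L"
      and k: "represents k L'" "ground L' = E" "nearly_finitary L'" for h k :: "'a set \<Rightarrow> 'a set" and L L'
  proof -
    interpret F: loops_outside "cl_fin h" E by (rule fini[OF h(1,2)])
    interpret G: loops_outside "cl_fin k" E by (rule fini[OF k(1,2)])
    interpret matroid_pair "cl_fin h" "cl_fin k"
      by (intro matroid_pair.intro F.imatroid_axioms G.imatroid_axioms)
    have "countable (- cl_fin k {})" by (rule countable_subset[OF _ count]) (use G.out in blast)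
    then have "has_intersection (cl_fin h) (cl_fin k)" by (rule has_intersection_finitary[OF finitary_fin finitary_fin])
    then have "has_intersection h (cl_fin k)" by (rule near[OF h(1,3) G.imatroid_axioms])
    then have "has_intersection (cl_fin k) h" by (rule has_intersection_sym)
    then have "has_intersection k h" by (rule near[OF k(1,3) im[OF dl(4)[OF h(1,2)]]])
    then show ?thesis by (rule has_intersection_sym)
  qed
  \<comment> \<open>Solve for the finitarization of \<open>L\<close> and the dual of the
    finitarization of the dual of \<open>L'\<close>. As \<open>near\<close> only removes
    finitarizations, the return to \<open>k\<close> takes place in the dual; \<open>near\<close>
    then returns to \<open>h\<close>.\<close>
  have fc: "has_intersection h k"
    if h: "represents h L" "ground L = E" "nearly_finitary L"
      and k: "represents k L'" "ground L' = E" "nearly_cofinitary L'" for h k :: "'a set \<Rightarrow> 'a set" and L L'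
  proof -
    note k' = dl[OF k(1,2)]
    let ?k = "cl_dual E k"
    interpret F: loops_outside "cl_fin h" E by (rule fini[OF h(1,2)])
    interpret G: loops_outside "cl_fin ?k" E by (rule fini[OF k'(1,2)])
    interpret Gd: loops_outside "cl_dual E (cl_fin ?k)" E by (rule G.loops_outside_dual)
    interpret Fd: loops_outside "cl_dual E (cl_fin h)" E by (rule F.loops_outside_dual)
    interpret matroid_pair "cl_fin h" "cl_dual E (cl_fin ?k)"
      by (intro matroid_pair.intro F.imatroid_axioms Gd.imatroid_axioms)
    have dd: "cl_dual E (cl_dual E (cl_fin ?k)) = cl_fin ?k" by (rule dual_dual[OF G.imatroid_axioms G.out])
    have ddh: "cl_dual E (cl_dual E (cl_fin h)) = cl_fin h" by (rule dual_dual[OF F.imatroid_axioms F.out])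
    have "has_intersection (cl_fin h) (cl_dual E (cl_fin ?k))"
      by (rule has_intersection_mixed[OF finitary_fin _ Gd.out]) (simp add: dd finitary_fin)
    then have "has_intersection (cl_dual E (cl_fin h)) (cl_dual E (cl_dual E (cl_fin ?k)))"
      by (rule has_intersection_dual[OF F.loops_outside_axioms Gd.loops_outside_axioms])
    then have "has_intersection (cl_fin ?k) (cl_dual E (cl_fin h))" unfolding dd by (rule has_intersection_sym)
    then have "has_intersection ?k (cl_dual E (cl_fin h))"
      by (rule near[OF k'(1) k(3)[unfolded nearly_cofinitary_def] Fd.imatroid_axioms])
    then have "has_intersection (cl_dual E ?k) (cl_dual E (cl_dual E (cl_fin h)))"
      by (rule has_intersection_dual[OF loops_outside.loops_outside_dual[OF k'(4)] Fd.loops_outside_axioms])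
    then have "has_intersection (cl_fin h) k" unfolding ddh k'(3) by (rule has_intersection_sym)
    then show ?thesis by (rule near[OF h(1,3) im[OF k'(4)]])
  qed
  note M' = dl[OF M] and N' = dl[OF N]
  consider "nearly_finitary M" "nearly_finitary N" | "nearly_finitary M" "nearly_cofinitary N"
    | "nearly_cofinitary M" "nearly_finitary N" | "nearly_cofinitary M" "nearly_cofinitary N"
    using nM nN by blast
  then show ?thesis
  proof cases
    case 1 then show ?thesis using ff[OF M _ N] by blast
  next
    case 2 then show ?thesis using fc[OF M _ N] by blast
  next
    case 3 then show ?thesis using fc[OF N _ M] has_intersection_sym by blast
  next
    case 4
    then have "has_intersection (cl_dual E f) (cl_dual E g)"
      using ff[OF M'(1,2) _ N'(1,2)] unfolding nearly_cofinitary_def by blast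
    then have "has_intersection (cl_dual E (cl_dual E f)) (cl_dual E (cl_dual E g))"
      by (rule has_intersection_dual[OF loops_outside.loops_outside_dual[OF M'(4)] loops_outside.loops_outside_dual[OF N'(4)]])
    then show ?thesis unfolding M'(3) N'(3) .
  qed
qed

section \<open>The intersection property and the condition \<open>cond\<close>\<close>

theorem theorem1p5:
  fixes M N :: "'a matroid" and E :: "'a set"
  assumes "matroid M" and "matroid N"
    and "ground M = E" and "ground N = E" and "countable E"
    and "nearly_finitary M \<or> nearly_cofinitary M"
    and "nearly_finitary N \<or> nearly_cofinitary N"
  shows "(\<exists>B. base N B \<and> B \<in> indeps M) \<longleftrightarrow> cond M N"
proof -
  define f where "f = matroid_cl M"
  define g where "g = matroid_cl N"
  have M: "represents f M" and N: "represents g N"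
    unfolding f_def g_def by (auto intro: matroid_ax.represents_matroid_cl matroid_ax.intro assms(1,2))
  interpret F: loops_outside f E using representsD(1)[OF M] assms(3) by simp
  interpret G: loops_outside g E using representsD(1)[OF N] assms(4) by simp
  have sol: "(\<exists>B. base N B \<and> B \<in> indeps M) \<longleftrightarrow> (\<exists>B. indep g B \<and> g B = UNIV \<and> indep f B)"
    using base_iff[OF N] representsD(2)[OF M] by blast
  have c: "cond M N \<longleftrightarrow> (\<forall>W. W \<subseteq> E \<longrightarrow>
    (\<exists>B. B \<subseteq> W \<and> indep f B \<and> W \<subseteq> f B \<and> indep (cl_contract g (- W)) B) \<longrightarrow>
    (\<exists>B. B \<subseteq> W \<and> indep (cl_contract g (- W)) B \<and> g (B \<union> - W) = UNIV \<and> indep f B))"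
    using cond_iff[OF M N] assms(3,4) by simp
  show ?thesis
    unfolding sol c
  proof (intro iffI allI impI)
    fix W assume "\<exists>B. indep g B \<and> g B = UNIV \<and> indep f B"
    then obtain B where B: "g B = UNIV" "indep f B" by blast
    \<comment> \<open>Since \<open>B\<close> spans \<open>g\<close>, a base \<open>C\<close> of
      \<open>B \<inter> W\<close> in the contraction onto \<open>W\<close> is a base of that whole
      contraction.\<close>
    obtain C where C: "C \<subseteq> B \<inter> W" "indep (cl_contract g (- W)) C" "B \<inter> W \<subseteq> cl_contract g (- W) C"
      using imatroid.basis[OF G.imatroid_contract[of "- W"], of "{}" "B \<inter> W"] by (auto simp: indep_def)
    have "B \<subseteq> g (C \<union> - W)" using C(3) G.ext[of "C \<union> - W"] unfolding cl_contract_def by blast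
    then have "g (C \<union> - W) = UNIV" using B(1) G.cl_least by blast
    moreover have "indep f C" by (rule F.indep_subset[OF B(2)]) (use C(1) in blast)
    ultimately show "\<exists>B. B \<subseteq> W \<and> indep (cl_contract g (- W)) B \<and> g (B \<union> - W) = UNIV \<and> indep f B"
      using C(1,2) by blast
  next
    assume cond: "\<forall>W. W \<subseteq> E \<longrightarrow>
      (\<exists>B. B \<subseteq> W \<and> indep f B \<and> W \<subseteq> f B \<and> indep (cl_contract g (- W)) B) \<longrightarrow>
      (\<exists>B. B \<subseteq> W \<and> indep (cl_contract g (- W)) B \<and> g (B \<union> - W) = UNIV \<and> indep f B)"
    obtain I R where I: "indep f I" "indep g I" "R \<subseteq> f (I \<inter> R)" "- R \<subseteq> g (I - R)"
      using nearly_finitary_intersection[OF M assms(3) N assms(4,5,6,7)] unfolding has_intersection_def by blast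
    define W where "W = R \<inter> E"
    have IE: "I \<subseteq> E" by (rule F.indep_ground[OF I(1)])
    have IW: "I \<inter> W = I \<inter> R" "I - W = I - R" using IE unfolding W_def by blast+
    have span: "- W \<subseteq> g (I - R)" using I(4) G.outE unfolding W_def by blast
    have "indep (cl_contract g (I - I \<inter> W \<union> {})) (I \<inter> W)"
      by (rule G.indep_contr_rest) (use I(2) in auto)
    moreover have "I - I \<inter> W \<union> {} = I - R" using IW by blast
    ultimately have "indep (cl_contract g (- W)) (I \<inter> W)" using G.indep_contr_mono[OF _ span] by simp
    moreover have "indep f (I \<inter> W)" by (rule F.indep_subset[OF I(1)]) blast
    moreover have "W \<subseteq> f (I \<inter> W)" using I(3) unfolding IW by (auto simp: W_def)
    moreover have "W \<subseteq> E" unfolding W_def by blast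
    ultimately obtain B where B: "B \<subseteq> W" "g (B \<union> - W) = UNIV" "indep f B"
      using cond by (metis Int_lower2)
    \<comment> \<open>\<open>I - R\<close> is independent in \<open>f\<close> over
      \<open>I \<inter> R\<close>, which spans \<open>R\<close> and so \<open>B\<close>; hence it
      can be added to \<open>B\<close>.\<close>
    have "indep (cl_contract f (I - (I - R) \<union> {})) (I - R)"
      by (rule F.indep_contr_rest) (use I(1) in auto)
    moreover have "B \<subseteq> f (I - (I - R) \<union> {})"
    proof -
      have "I - (I - R) \<union> {} = I \<inter> R" by blast
      then show ?thesis using B(1) I(3) unfolding W_def by auto
    qed
    ultimately have "indep (cl_contract f B) (I - R)" by (rule F.indep_contr_mono)
    then have K: "indep f (B \<union> (I - R))" by (rule F.indep_Un[OF B(3)])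
    have "B \<union> - W \<subseteq> g (B \<union> (I - R))"
      using span G.ext[of "B \<union> (I - R)"] G.mono[of "I - R" "B \<union> (I - R)"] by blast
    then have KU: "g (B \<union> (I - R)) = UNIV" using B(2) G.cl_least by blast
    obtain K where K': "K \<subseteq> B \<union> (I - R)" "indep g K" "B \<union> (I - R) \<subseteq> g K"
      using G.basis[of "{}" "B \<union> (I - R)"] by auto
    have "g K = UNIV" using KU G.cl_least[OF K'(3)] by blast
    then show "\<exists>B. indep g B \<and> g B = UNIV \<and> indep f B"
      using K'(2) F.indep_subset[OF K K'(1)] by blast
  qed
qed

end
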